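(* Let $\lambda(t)$ be the linear intensity process described in the context, with initial value $\lambda(0)=\lambda>0$, and put $\rho:=\beta E[X]-\alpha$ and $A:=2\alpha\lambda_0+\beta^2E[X^2]$. Let $m(t)=E[\lambda(t)]$ and let $v(t):=E[\lambda^2(t)]$. Then $v$ satisfies $$v'(t)=A\,m(t)+2\rho\,v(t),\qquad v(0)=\lambda^2,$$ and, if $\rho\neq0$, for all $t\ge0$, $$v(t)=v_0+v_1e^{\rho t}+v_2e^{2\rho t},$$ where $$v_0=\frac{A\alpha\lambda_0}{2\rho^2},\qquad v_1=-\frac{A}{\rho}\Big(\frac{\alpha\lambda_0}{\rho}+\lambda\Big),\qquad v_2=\frac{A}{2\rho^2}(\alpha\lambda_0+2\rho\lambda)+\lambda^2.$$
   Context: Linear self-exciting intensity: let $\{T_n\}_{n\ge1}$ be a non-negative non-decreasing sequence of random times adapted to a filtration $\{\mathcal F_t\}_{t\ge0}$, with counting process $N(t)=\sum_{n\ge1}1_{\{T_n\le t\}}$ having $\mathcal F_t$-adapted, càdlàg, non-negative intensity $\lambda(t)$, meaning $E[\int_0^\infty f(s)\,dN(s)]=E[\int_0^\infty f(s)\lambda(s)\,ds]$ for all non-negative predictable $f$. Put $U(t)=\sum_{n=1}^{N(t)}X_n$, where the jump sizes $X_n$ are i.i.d. with the law of a random variable $X$, each $X_n$ being independent of the history strictly before $T_n$ (in particular of the value of the intensity); $E[X^2]<\infty$, and the jump law is such that $\lambda_0-\lambda(T_n-)\le X_n$ for every $n$. The intensity solves $$d\lambda(t)=\alpha(\lambda_0-\lambda(t))\,dt+\beta\,dU(t),$$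 with constants $\alpha,\beta\in\mathbb R$, $\lambda_0>0$, started from a deterministic value $\lambda(0)=\lambda$.
   Formalization: The times T_n are assumed almost surely strictly increasing while finite (N has unit jumps), not merely non-decreasing: with simultaneous events the equation for v can fail, e.g. for events in pairs at rate λ(t)/2 with α=0, β=1, X=1. *)

theory Defs
  imports "HOL-Probability.Probability"
begin

text \<open>
  Time is \<open>[0,\<infinity>)\<close>; processes are functions of a real time that are only looked at for \<open>t \<ge> 0\<close>.
  Event times take values in \<open>[0,\<infinity>]\<close>, the value \<open>\<infinity>\<close> meaning that the event does not occur.
  So that the library notions \<open>filtration\<close> and \<open>stopping_time\<close> apply to them, filtrations are
  indexed by \<open>ennreal\<close>; the \<open>\<sigma>\<close>-algebra at \<open>\<infinity>\<close> carries no information that is used anywhere.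
  Sequences of events are indexed from 1; the values at index 0 are never used.
\<close>

text \<open>The random measure \<open>dN\<close> on the time axis, i.e. the sum of unit masses at the finite \<open>T n \<omega>\<close>.\<close>

definition jump_measure :: "(nat \<Rightarrow> 'a \<Rightarrow> ennreal) \<Rightarrow> 'a \<Rightarrow> real measure" where
  "jump_measure T \<omega> =
     distr (count_space {n. 1 \<le> n \<and> T n \<omega> < \<infinity>}) borel (\<lambda>n. enn2real (T n \<omega>))"

text \<open>
  \<open>card\<close> returns 0 if infinitely many events occur up to time \<open>t\<close>.  For a point process whose
  intensity has cadlag paths this has probability 0.
\<close>

definition counting_process :: "(nat \<Rightarrow> 'a \<Rightarrow> ennreal) \<Rightarrow> real \<Rightarrow> 'a \<Rightarrow> nat" where
  "counting_process T t \<omega> = card {n. 1 \<le> n \<and> T n \<omega> \<le> ennreal t}"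

definition compound_process ::
    "(nat \<Rightarrow> 'a \<Rightarrow> ennreal) \<Rightarrow> (nat \<Rightarrow> 'a \<Rightarrow> real) \<Rightarrow> real \<Rightarrow> 'a \<Rightarrow> real" where
  "compound_process T Xs t \<omega> = (\<Sum>n = 1..counting_process T t \<omega>. Xs n \<omega>)"

lemma emeasure_jump_measure:
  assumes "0 \<le> t" and fin: "finite {n. 1 \<le> n \<and> T n \<omega> \<le> ennreal t}"
  shows "emeasure (jump_measure T \<omega>) {0..t} = of_nat (counting_process T t \<omega>)"
proof -
  let ?I = "{n. 1 \<le> n \<and> T n \<omega> < \<infinity>}" and ?J = "{n. 1 \<le> n \<and> T n \<omega> \<le> ennreal t}"
  have iff: "enn2real (T n \<omega>) \<le> t \<longleftrightarrow> T n \<omega> \<le> ennreal t" if "T n \<omega> < \<infinity>" for n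
    using that \<open>0 \<le> t\<close> by (cases "T n \<omega>") auto
  have lt: "T n \<omega> < \<infinity>" if "T n \<omega> \<le> ennreal t" for n
    using that by (metis ennreal_less_top infinity_ennreal_def order_le_less_trans)
  have "(\<lambda>n. enn2real (T n \<omega>)) -` {0..t} \<inter> ?I = ?J"
    using iff lt by auto
  moreover have "?J \<subseteq> ?I"
    using lt by auto
  ultimately show ?thesis
    using fin by (simp add: jump_measure_def counting_process_def emeasure_distr)
qed

definition predictable_sigma :: "'a set \<Rightarrow> (ennreal \<Rightarrow> 'a measure) \<Rightarrow> (real \<times> 'a) measure" where
  "predictable_sigma \<Omega> F = sigma ({0..} \<times> \<Omega>)
     ({{0} \<times> A | A. A \<in> sets (F 0)} \<union>
      {{s<..t} \<times> A | s t A. 0 \<le> s \<and> s \<le> t \<and> A \<in> sets (F (ennreal s))})"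

text \<open>The \<open>\<sigma>\<close>-algebra of events strictly prior to a random time.\<close>

definition strict_past :: "'a set \<Rightarrow> (ennreal \<Rightarrow> 'a measure) \<Rightarrow> ('a \<Rightarrow> ennreal) \<Rightarrow> 'a measure" where
  "strict_past \<Omega> F \<tau> = sigma \<Omega> (sets (F 0) \<union> {{\<omega> \<in> A. t < \<tau> \<omega>} | t A. A \<in> sets (F t)})"

definition cadlag_path :: "(real \<Rightarrow> real) \<Rightarrow> bool" where
  "cadlag_path x \<longleftrightarrow>
     (\<forall>t\<ge>0. (x \<longlongrightarrow> x t) (at_right t)) \<and> (\<forall>t>0. \<exists>y. (x \<longlongrightarrow> y) (at_left t))"

definition has_intensity ::
    "'a measure \<Rightarrow> (ennreal \<Rightarrow> 'a measure) \<Rightarrow> (nat \<Rightarrow> 'a \<Rightarrow> ennreal) \<Rightarrow> (real \<Rightarrow> 'a \<Rightarrow> real) \<Rightarrow> bool" where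
  "has_intensity M F T lam \<longleftrightarrow>
     (\<forall>t\<ge>0. lam t \<in> borel_measurable (F (ennreal t))) \<and>
     (\<forall>\<omega>\<in>space M. cadlag_path (\<lambda>t. lam t \<omega>) \<and> (\<forall>t\<ge>0. 0 \<le> lam t \<omega>)) \<and>
     (\<forall>f :: real \<times> 'a \<Rightarrow> ennreal. f \<in> borel_measurable (predictable_sigma (space M) F) \<longrightarrow>
        (\<integral>\<^sup>+\<omega>. (\<integral>\<^sup>+s\<in>{0..}. f (s, \<omega>) \<partial>jump_measure T \<omega>) \<partial>M) =
        (\<integral>\<^sup>+\<omega>. (\<integral>\<^sup>+s\<in>{0..}. f (s, \<omega>) * ennreal (lam s \<omega>) \<partial>lborel) \<partial>M))"

text \<open>
  \<open>X\<close> is the generic jump size, \<open>Xs n\<close> the \<open>n\<close>-th jump size, \<open>lam0\<close> the base level and \<open>l\<close>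
  the initial value of the intensity process \<open>lam\<close>.

  The event times strictly increase as long as they are finite: \<open>N\<close> is a counting process
  with unit jumps.  The defining identity of the intensity alone does not force this: with pairs of
  simultaneous events at rate \<open>lam / 2\<close> it still holds, but each pair would contribute an extra
  cross term of the two jump sizes to the second moment of \<open>lam\<close>.
\<close>

locale linear_self_exciting = prob_space M + filtration "space M" F
  for M :: "'a measure" and F :: "ennreal \<Rightarrow> 'a measure" +
  fixes T :: "nat \<Rightarrow> 'a \<Rightarrow> ennreal"
    and X :: "'a \<Rightarrow> real" and Xs :: "nat \<Rightarrow> 'a \<Rightarrow> real"
    and \<alpha> \<beta> lam0 l :: real
    and lam :: "real \<Rightarrow> 'a \<Rightarrow> real"
  assumes sub: "\<And>t. subalgebra M (F t)"
    and event_times: "\<And>n. 1 \<le> n \<Longrightarrow> stopping_time F (T n)"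
    and nondecreasing: "\<And>n \<omega>. 1 \<le> n \<Longrightarrow> \<omega> \<in> space M \<Longrightarrow> T n \<omega> \<le> T (Suc n) \<omega>"
    and simple: "AE \<omega> in M. \<forall>n\<ge>1. T n \<omega> < \<infinity> \<longrightarrow> T n \<omega> < T (Suc n) \<omega>"
    and intensity: "has_intensity M F T lam"
    and X_rv: "random_variable borel X"
    and X_square: "integrable M (\<lambda>\<omega>. (X \<omega>)\<^sup>2)"
    and jumps_indep: "indep_vars (\<lambda>_. borel) Xs {1..}"
    and jumps_law: "\<And>n. 1 \<le> n \<Longrightarrow> distr M borel (Xs n) = distr M borel X"
    and jumps_indep_past: "\<And>n. 1 \<le> n \<Longrightarrow>
          indep_set (sets (strict_past (space M) F (T n))) (sets (vimage_algebra (space M) (Xs n) borel))"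
    and jumps_lower: "AE \<omega> in M. \<forall>n\<ge>1. T n \<omega> < \<infinity> \<longrightarrow>
          lam0 - Lim (at_left (enn2real (T n \<omega>))) (\<lambda>s. lam s \<omega>) \<le> Xs n \<omega>"
    and lam0_pos: "0 < lam0"
    and initial: "\<And>\<omega>. \<omega> \<in> space M \<Longrightarrow> lam 0 \<omega> = l"
    and dynamics: "AE \<omega> in M. \<forall>t\<ge>0. lam t \<omega> =
          lam 0 \<omega> + (LINT s:{0..t}|lborel. \<alpha> * (lam0 - lam s \<omega>)) + \<beta> * compound_process T Xs t \<omega>"

end

theory Submission
  imports Defs
begin

text \<open>
  At an event time the square of the intensity jumps by
  \<open>2 \<beta> lam(T\<^sub>n-) X\<^sub>n + \<beta>\<^sup>2 X\<^sub>n\<^sup>2\<close>, and between events it moves by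
  \<open>2 \<alpha> (lam0 lam - lam\<^sup>2) dt\<close>.  Since predictable processes evaluated at \<open>T n\<close> are measurable with
  respect to the strict past of \<open>T n\<close>, they are independent of \<open>Xs n\<close>; hence for
  predictable \<open>f\<close> the intensity formula gives \<open>E (\<Sum> f(T\<^sub>n) g(X\<^sub>n)) = E g(X) \<sqdot> E (\<integral> f lam dt)\<close> (Campbell's formula), and taking expectations yields
  the integrated form of \<open>v' = A m + 2 \<rho> v\<close>.

  Integrability comes from the same computation with the intensity stopped at its first passage
  above \<open>k\<close>: there everything is bounded, Gronwall's inequality gives a bound independent of \<open>k\<close>,
  and Fatou's lemma lets \<open>k\<close> tend to infinity.  Non-explosion also follows by stopping, because
  the stopped intensity has a finite time integral.
\<close>

subsection \<open>Paths, Gronwall and linear differential equations\<close>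

text \<open>No moment of \<open>lam\<close> is assumed finite, and the terms in the square of a path
  have both signs, so expectations cannot be taken before integrability is known. The expectation is
  therefore computed once for a general predictable weight \<open>Y\<close>
  (\<open>expectation_stopped_square\<close>) and used twice: with
  \<open>indicator (below k)\<close>, where the integrands are bounded, and with the constant 1 once
  the moments are bounded.

  The intensity need not be predictable, and at \<open>T n\<close> it already contains the mark
  \<open>Xs n\<close>. The factor paired with the mark has to be the left limit
  \<open>lam_left\<close>; this costs nothing in time integrals, since the two differ at countably
  many times only.

  Stopping bounds the integrands, not the stopped intensity itself: the jump that crosses
  \<open>k\<close> may overshoot by any amount, and there the predictable weight is still 1. The
  overshoot is paid for by the second moment of \<open>X\<close>.\<close>

lemma cadlag_path_bounded:
  assumes x: "cadlag_path x" and "0 \<le> t"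
  shows "\<exists>K. \<forall>s\<in>{0..t}. \<bar>x s\<bar> \<le> K"
proof -
  \<comment> \<open>The guards \<open>0 \<le> s\<close> and \<open>s \<le> t\<close> allow the small
    intervals in the bisection argument to stick out of \<open>{0..t}\<close>, where nothing is
    known about \<open>x\<close>. At \<open>u = 0\<close> they make the left half vacuous.\<close>
  define P where "P = (\<lambda>a b. \<exists>K. \<forall>s\<in>{a..b}. 0 \<le> s \<longrightarrow> s \<le> t \<longrightarrow> \<bar>x s\<bar> \<le> K)"
  have "P 0 t"
    using \<open>0 \<le> t\<close>
  proof (induction rule: Bolzano[where P = P])
    case (trans a b c)
    then obtain K L where "\<forall>s\<in>{a..b}. 0 \<le> s \<longrightarrow> s \<le> t \<longrightarrow> \<bar>x s\<bar> \<le> K" "\<forall>s\<in>{b..c}. 0 \<le> s \<longrightarrow> s \<le> t \<longrightarrow> \<bar>x s\<bar> \<le> L"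
      unfolding P_def by blast
    then show ?case
      unfolding P_def by (intro exI[of _ "max K L"]) (metis atLeastAtMost_iff le_max_iff_disj linear)
  next
    case (local u)
    have "(x \<longlongrightarrow> x u) (at_right u)"
      using x local by (auto simp: cadlag_path_def)
    then have "eventually (\<lambda>s. dist (x s) (x u) < 1) (at_right u)"
      by (rule tendstoD) simp
    then have "eventually (\<lambda>s. \<bar>x s\<bar> \<le> \<bar>x u\<bar> + 1) (at_right u)"
      by eventually_elim (simp add: dist_real_def)
    then obtain b where b: "b > u" "\<And>s. u < s \<Longrightarrow> s < b \<Longrightarrow> \<bar>x s\<bar> \<le> \<bar>x u\<bar> + 1"
      unfolding eventually_at_right_field by blast
    obtain a K where a: "a < u" "\<And>s. 0 \<le> s \<Longrightarrow> a < s \<Longrightarrow> s < u \<Longrightarrow> \<bar>x s\<bar> \<le> K"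
    proof (cases "0 < u")
      case True
      then obtain y where "(x \<longlongrightarrow> y) (at_left u)"
        using x by (auto simp: cadlag_path_def)
      then have "eventually (\<lambda>s. dist (x s) y < 1) (at_left u)"
        by (rule tendstoD) simp
      then have "eventually (\<lambda>s. \<bar>x s\<bar> \<le> \<bar>y\<bar> + 1) (at_left u)"
        by eventually_elim (simp add: dist_real_def)
      then obtain a where a: "a < u" "\<And>s. a < s \<Longrightarrow> s < u \<Longrightarrow> \<bar>x s\<bar> \<le> \<bar>y\<bar> + 1"
        unfolding eventually_at_left_field by blast
      then show ?thesis using that by blast
    next
      case False
      then show ?thesis using that[of "u - 1" 0] by auto
    qed
    have "\<bar>x s\<bar> \<le> max (\<bar>x u\<bar> + 1) K" if "0 \<le> s" "a < s" "s < b" for s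
      using a(2)[of s] b(2)[of s] that by (cases s u rule: linorder_cases) auto
    then have "\<forall>c d. c \<le> u \<and> u \<le> d \<and> d - c < min (u - a) (b - u) \<longrightarrow>
        (\<forall>s\<in>{c..d}. 0 \<le> s \<longrightarrow> s \<le> t \<longrightarrow> \<bar>x s\<bar> \<le> max (\<bar>x u\<bar> + 1) K)"
      by (auto simp: min_def split: if_splits)
    moreover have "0 < min (u - a) (b - u)"
      using a(1) b(1) by simp
    ultimately show ?case
      unfolding P_def by blast
  qed
  then show ?thesis by (auto simp: P_def)
qed

text \<open>The square is the integral of \<open>f s * f u\<close> over the plane. The diagonal cuts
  it into two triangles, and by Fubini both contribute the same iterated integral. This needs
  integrability of \<open>f\<close> only; the drift of a path with jumps is not continuous, so a
  chain rule for differentiable functions would not apply.\<close>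

lemma square_of_integral:
  fixes f :: "real \<Rightarrow> real" and l :: real
  assumes f: "integrable lborel f"
  shows "(l + (LBINT s. f s))\<^sup>2 = l\<^sup>2 + (LBINT s. 2 * (l + (LBINT u. indicator {..s} u * f u)) * f s)"
    and "integrable lborel (\<lambda>s. 2 * (l + (LBINT u. indicator {..s} u * f u)) * f s)"
proof -
  define P where "P = (\<lambda>(s, u). (if u \<le> s then f s * f u else 0))"
  define Q where "Q = (\<lambda>(s, u). (if s < u then f s * f u else 0))"
  note [measurable] = borel_measurable_integrable[OF f]
  interpret pair_sigma_finite "lborel :: real measure" "lborel :: real measure" ..
  have int: "integrable (lborel \<Otimes>\<^sub>M lborel) (\<lambda>(s, u). f s * f u)"
    by (rule lborel_pair.Fubini_integrable) (use f in \<open>auto simp: split_beta abs_mult\<close>)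
  have P: "integrable (lborel \<Otimes>\<^sub>M lborel) P"
    unfolding P_def by (rule Bochner_Integration.integrable_bound[OF int]) (auto simp: split_beta)
  have Q: "integrable (lborel \<Otimes>\<^sub>M lborel) Q"
    unfolding Q_def by (rule Bochner_Integration.integrable_bound[OF int]) (auto simp: split_beta)
  have PI: "(LBINT u. P (s, u)) = (LBINT u. indicator {..s} u * f u) * f s" for s
    unfolding integral_mult_left_zero[symmetric]
    by (intro Bochner_Integration.integral_cong) (auto simp: P_def indicator_def)
  have QI: "(LBINT s. Q (s, u)) = (LBINT u'. indicator {..u} u' * f u') * f u" for u
    unfolding integral_mult_left_zero[symmetric]
    by (intro integral_cong_AE)
      (auto simp: Q_def indicator_def intro!: eventually_mono[OF AE_lborel_singleton[of u]])
  have "(LBINT s. f s)\<^sup>2 = (LBINT s. (LBINT u. f s * f u))"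
    by (simp add: power2_eq_square)
  also have "\<dots> = integral\<^sup>L (lborel \<Otimes>\<^sub>M lborel) (\<lambda>(s, u). f s * f u)"
    using lborel_pair.integral_fst'[OF int] by simp
  also have "\<dots> = integral\<^sup>L (lborel \<Otimes>\<^sub>M lborel) (\<lambda>x. P x + Q x)"
    by (intro Bochner_Integration.integral_cong) (auto simp: P_def Q_def)
  also have "\<dots> = integral\<^sup>L (lborel \<Otimes>\<^sub>M lborel) P + integral\<^sup>L (lborel \<Otimes>\<^sub>M lborel) Q"
    using P Q by simp
  also have "integral\<^sup>L (lborel \<Otimes>\<^sub>M lborel) P = (LBINT s. (LBINT u. P (s, u)))"
    using lborel_pair.integral_fst'[OF P] by simp
  also have "integral\<^sup>L (lborel \<Otimes>\<^sub>M lborel) Q = (LBINT u. (LBINT s. Q (s, u)))"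
    using lborel_pair.integral_snd[of "\<lambda>s u. Q (s, u)"] Q by simp
  finally have sq: "(LBINT s. f s)\<^sup>2 = 2 * (LBINT s. (LBINT u. indicator {..s} u * f u) * f s)"
    by (simp add: PI QI)
  have i: "integrable lborel (\<lambda>s. (LBINT u. indicator {..s} u * f u) * f s)"
    using lborel_pair.integrable_fst'[OF P] by (simp add: PI)
  have e: "2 * (l + (LBINT u. indicator {..s} u * f u)) * f s =
     2 * l * f s + 2 * ((LBINT u. indicator {..s} u * f u) * f s)" for s
    by (simp add: algebra_simps)
  show "(l + (LBINT s. f s))\<^sup>2 = l\<^sup>2 + (LBINT s. 2 * (l + (LBINT u. indicator {..s} u * f u)) * f s)"
    unfolding e using i f sq by (simp add: power2_sum)
  show "integrable lborel (\<lambda>s. 2 * (l + (LBINT u. indicator {..s} u * f u)) * f s)"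
    unfolding e using i f by simp
qed

text \<open>Ito's formula.  The jump times \<open>\<tau>\<close> need not be ordered, so induction on \<open>N\<close> works with a fixed \<open>f\<close>.\<close>

lemma square_of_jump_path:
  fixes f :: "real \<Rightarrow> real" and c \<tau> :: "nat \<Rightarrow> real" and l t :: real and N :: nat
  assumes f: "integrable lborel f" and f0: "\<And>s. t < s \<Longrightarrow> f s = 0"
  defines "G s \<equiv> l + (LBINT u. indicator {..s} u * f u)"
  defines "y n s \<equiv> G s + (\<Sum>j | j \<in> {1..n} \<and> \<tau> j \<le> s. c j)"
  assumes \<tau>: "\<And>n. n \<in> {1..N} \<Longrightarrow> \<tau> n \<le> t"
  shows "(y N t)\<^sup>2 = l\<^sup>2 + (LBINT s. 2 * y N s * f s) + (\<Sum>n = 1..N. 2 * (G (\<tau> n) + (\<Sum>j = 1..<n. c j)) * c n + (c n)\<^sup>2)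
      \<and> integrable lborel (\<lambda>s. 2 * y N s * f s)"
proof -
  have Gt: "G t = l + (LBINT s. f s)"
    unfolding G_def using f0 by (auto intro!: Bochner_Integration.integral_cong simp: indicator_def)
  show ?thesis
    using \<tau>
  proof (induction N)
    case 0
    have "y 0 s = G s" for s by (simp add: y_def)
    then show ?case
      using square_of_integral[OF f, of l] Gt by (simp add: G_def)
  next
    case (Suc N)
    note [measurable] = borel_measurable_integrable[OF f]
    let ?\<tau> = "\<tau> (Suc N)" and ?c = "c (Suc N)"
    have y: "y (Suc N) s = y N s + ?c * indicator {?\<tau>..} s" for s
    proof -
      have "{j. j \<in> {1..Suc N} \<and> \<tau> j \<le> s} =
          {j. j \<in> {1..N} \<and> \<tau> j \<le> s} \<union> (if ?\<tau> \<le> s then {Suc N} else {})"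
        by (auto simp: le_Suc_eq)
      then show ?thesis
        by (auto simp: y_def indicator_def)
    qed
    have IH: "(y N t)\<^sup>2 = l\<^sup>2 + (LBINT s. 2 * y N s * f s) + (\<Sum>n = 1..N. 2 * (G (\<tau> n) + (\<Sum>j = 1..<n. c j)) * c n + (c n)\<^sup>2)"
        "integrable lborel (\<lambda>s. 2 * y N s * f s)"
      using Suc by auto
    have i1: "integrable lborel (\<lambda>s. indicator {?\<tau>..} s * f s)"
      using integrable_mult_indicator[OF _ f, of "{?\<tau>..}"] by simp
    have i2: "integrable lborel (\<lambda>s. indicator {..?\<tau>} s * f s)"
      using integrable_mult_indicator[OF _ f, of "{..?\<tau>}"] by simp
    have e: "2 * y (Suc N) s * f s = 2 * y N s * f s + 2 * ?c * (indicator {?\<tau>..} s * f s)" for s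
      by (simp add: y algebra_simps)
    have "(LBINT s. f s) = (LBINT s. indicator {?\<tau>..} s * f s + indicator {..?\<tau>} s * f s)"
      by (intro integral_cong_AE)
        (auto intro!: eventually_mono[OF AE_lborel_singleton[of ?\<tau>]] simp: indicator_def)
    then have "(LBINT s. indicator {?\<tau>..} s * f s) = G t - G ?\<tau>"
      unfolding Gt unfolding G_def using i1 i2 by simp
    then have I: "(LBINT s. 2 * y (Suc N) s * f s) = (LBINT s. 2 * y N s * f s) + 2 * ?c * (G t - G ?\<tau>)"
      unfolding e using IH(2) i1 by simp
    have "{j. 1 \<le> j \<and> j \<le> N \<and> \<tau> j \<le> t} = {1..N}" using Suc.prems by auto
    then have yt: "y N t = G t + (\<Sum>j = 1..N. c j)"
      by (simp add: y_def)
    have yt': "y (Suc N) t = y N t + ?c"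
      using Suc.prems[of "Suc N"] by (simp add: y)
    \<comment> \<open>The drift integral grows by \<open>2 * ?c * (G t - G ?\<tau>)\<close> and the
      new summand carries \<open>2 * ?c * G ?\<tau>\<close>. The position of \<open>?\<tau>\<close>
      cancels, and the cross term \<open>2 * ?c * y N t\<close> remains, wherever
      \<open>?\<tau>\<close> lies among the earlier jump times.\<close>
    have "(y (Suc N) t)\<^sup>2 = (y N t)\<^sup>2 + 2 * ?c * y N t + ?c\<^sup>2"
      unfolding yt' by (simp add: power2_sum)
    moreover have "integrable lborel (\<lambda>s. 2 * y (Suc N) s * f s)"
      unfolding e using IH(2) i1 by simp
    moreover have "{1..<Suc N} = {1..N}" by auto
    ultimately show ?case
      unfolding I using IH(1) yt by (simp add: algebra_simps)
  qed
qed

text \<open>As \<open>w\<close> is merely measurable, the proof compares suprema of \<open>exp (- 2 * C * s) * w s\<close>.\<close>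

lemma gronwall_bounded:
  fixes w :: "real \<Rightarrow> real"
  assumes [measurable]: "w \<in> borel_measurable borel"
    and bd: "\<And>s. s \<in> {0..t} \<Longrightarrow> 0 \<le> w s \<and> w s \<le> K"
    and ineq: "\<And>s. s \<in> {0..t} \<Longrightarrow> w s \<le> B + C * (LINT u:{0..s}|lborel. w u)"
    and "0 \<le> B" "0 < C" "0 \<le> t"
  shows "w t \<le> 2 * B * exp (2 * C * t)"
proof -
  define S where "S = (SUP s\<in>{0..t}. exp (- 2 * C * s) * w s)"
  have ne: "{0..t} \<noteq> {}" using \<open>0 \<le> t\<close> by auto
  have bdd: "bdd_above ((\<lambda>s. exp (- 2 * C * s) * w s) ` {0..t})"
  proof (rule bdd_aboveI2)
    fix s assume s: "s \<in> {0..t}"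
    then have "exp (- 2 * C * s) * w s \<le> 1 * w s"
      using bd[OF s] \<open>0 < C\<close> by (intro mult_right_mono) auto
    then show "exp (- 2 * C * s) * w s \<le> K" using bd[OF s] by simp
  qed
  have w_le: "w s \<le> S * exp (2 * C * s)" if s: "s \<in> {0..t}" for s
  proof -
    have "exp (- 2 * C * s) * w s \<le> S"
      unfolding S_def by (rule cSUP_upper[OF s bdd])
    then have "exp (2 * C * s) * (exp (- 2 * C * s) * w s) \<le> exp (2 * C * s) * S"
      by (intro mult_left_mono) auto
    then show ?thesis
      by (simp add: exp_minus field_simps)
  qed
  have S0: "0 \<le> S"
  proof -
    have "0 \<le> exp (- 2 * C * t) * w t" using bd[of t] \<open>0 \<le> t\<close> by auto
    also have "\<dots> \<le> S" unfolding S_def using \<open>0 \<le> t\<close> by (intro cSUP_upper[OF _ bdd]) auto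
    finally show ?thesis .
  qed
  \<comment> \<open>The rate \<open>2 * C\<close> is twice the sharp one: integrating the envelope
    \<open>S * exp (2 * C * u)\<close> costs a factor \<open>1 / (2 * C)\<close>, so only
    \<open>S / 2\<close> comes back and can be absorbed on the left. Both factors 2 in the
    conclusion originate here.\<close>
  have "S \<le> B + S / 2"
    unfolding S_def
  proof (rule cSUP_least[OF ne], fold S_def)
    fix s assume s: "s \<in> {0..t}"
    have FTC: "has_bochner_integral lborel (\<lambda>u. S * exp (2 * C * u) * indicator {0..s} u)
        (S * exp (2 * C * s) / (2 * C) - S * exp (2 * C * 0) / (2 * C))"
      using s \<open>0 < C\<close>
      by (intro has_bochner_integral_FTC_Icc_real) (auto intro!: derivative_eq_intros continuous_intros)
    have "integrable lborel (\<lambda>u. indicator {0..s} u * w u)"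
    proof (rule Bochner_Integration.integrable_bound)
      show "integrable lborel (\<lambda>u. S * exp (2 * C * u) * indicator {0..s} u)"
        using FTC by (simp add: has_bochner_integral_iff)
      show "AE u in lborel. norm (indicator {0..s} u * w u) \<le> norm (S * exp (2 * C * u) * indicator {0..s} u)"
        using s w_le bd S0 by (auto simp: indicator_def abs_mult)
    qed simp
    then have "(LINT u:{0..s}|lborel. w u) \<le> (LBINT u. S * exp (2 * C * u) * indicator {0..s} u)"
      unfolding set_lebesgue_integral_def
      using FTC s w_le by (intro integral_mono) (auto simp: has_bochner_integral_iff indicator_def)
    also have "\<dots> = S * (exp (2 * C * s) - 1) / (2 * C)"
      using FTC by (simp add: has_bochner_integral_iff algebra_simps diff_divide_distrib)
    finally have "C * (LINT u:{0..s}|lborel. w u) \<le> C * (S * (exp (2 * C * s) - 1) / (2 * C))"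
      using \<open>0 < C\<close> by (intro mult_left_mono) auto
    also have "\<dots> = S / 2 * (exp (2 * C * s) - 1)"
      using \<open>0 < C\<close> by (simp add: field_simps)
    finally have "w s \<le> B + S / 2 * (exp (2 * C * s) - 1)"
      using ineq[OF s] by simp
    also have "\<dots> \<le> (B + S / 2) * exp (2 * C * s)"
    proof -
      have "B * 1 \<le> B * exp (2 * C * s)"
        using s \<open>0 < C\<close> \<open>0 \<le> B\<close> by (intro mult_left_mono) auto
      then show ?thesis using S0 by (simp add: algebra_simps)
    qed
    finally have "exp (- 2 * C * s) * w s \<le> exp (- 2 * C * s) * ((B + S / 2) * exp (2 * C * s))"
      by (intro mult_left_mono) auto
    also have "\<dots> = B + S / 2"
      by (simp add: exp_minus field_simps)
    finally show "exp (- 2 * C * s) * w s \<le> B + S / 2" .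
  qed
  then have "S \<le> 2 * B" by simp
  then have "S * exp (2 * C * t) \<le> 2 * B * exp (2 * C * t)" by (intro mult_right_mono) auto
  moreover have "w t \<le> S * exp (2 * C * t)"
    using w_le \<open>0 \<le> t\<close> by simp
  ultimately show ?thesis by (rule order_trans[rotated])
qed

text \<open>The index picks the last point of the grid of mesh \<open>1 / Suc j\<close> strictly
  before \<open>s\<close>. A floor would hit \<open>s\<close> itself whenever \<open>s\<close> lies
  on the grid, and a left limit says nothing about \<open>x s\<close>.\<close>

lemma tendsto_at_left_grid:
  fixes x :: "real \<Rightarrow> 'b::topological_space"
  assumes "(x \<longlongrightarrow> y) (at_left s)"
  shows "(\<lambda>j. x ((of_int \<lceil>s * real (Suc j)\<rceil> - 1) / real (Suc j))) \<longlonglongrightarrow> y"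
proof (rule filterlim_compose[OF assms])
  define z where "z j = (of_int \<lceil>s * real (Suc j)\<rceil> - 1) / real (Suc j)" for j
  have lt: "z j < s" for j
    unfolding z_def by (subst pos_divide_less_eq) (simp, linarith)
  have ge: "s - inverse (real (Suc j)) \<le> z j" for j
  proof -
    have "(s * real (Suc j) - 1) / real (Suc j) \<le> z j"
      unfolding z_def by (intro divide_right_mono) (auto intro: le_of_int_ceiling)
    then show ?thesis by (simp add: diff_divide_distrib inverse_eq_divide)
  qed
  have "(\<lambda>j. s - inverse (real (Suc j))) \<longlonglongrightarrow> s - 0"
    by (intro tendsto_intros LIMSEQ_inverse_real_of_nat)
  then have "(\<lambda>j. s - inverse (real (Suc j))) \<longlonglongrightarrow> s" by simp
  then have "z \<longlonglongrightarrow> s"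
    by (rule tendsto_sandwich[rotated 2])
      (auto intro!: always_eventually ge less_imp_le[OF lt] simp del: of_nat_Suc)
  then have "filterlim z (at_left s) sequentially"
    unfolding filterlim_at using lt by (auto simp: less_imp_neq)
  then show "filterlim (\<lambda>j. (of_int \<lceil>s * real (Suc j)\<rceil> - 1) / real (Suc j)) (at_left s) sequentially"
    unfolding z_def .
qed

lemma tendsto_at_right_grid:
  fixes x :: "real \<Rightarrow> 'b::topological_space"
  assumes "(x \<longlongrightarrow> y) (at_right s)"
  shows "(\<lambda>j. x ((of_int \<lfloor>s * real (Suc j)\<rfloor> + 1) / real (Suc j))) \<longlonglongrightarrow> y"
proof (rule filterlim_compose[OF assms])
  define z where "z j = (of_int \<lfloor>s * real (Suc j)\<rfloor> + 1) / real (Suc j)" for j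
  have gt: "s < z j" for j
    unfolding z_def by (subst pos_less_divide_eq) (simp, linarith)
  have le: "z j \<le> s + inverse (real (Suc j))" for j
  proof -
    have "z j \<le> (s * real (Suc j) + 1) / real (Suc j)"
      unfolding z_def by (intro divide_right_mono) (auto intro: of_int_floor_le)
    then show ?thesis by (simp add: add_divide_distrib inverse_eq_divide)
  qed
  have "(\<lambda>j. s + inverse (real (Suc j))) \<longlonglongrightarrow> s + 0"
    by (intro tendsto_intros LIMSEQ_inverse_real_of_nat)
  then have "(\<lambda>j. s + inverse (real (Suc j))) \<longlonglongrightarrow> s" by simp
  then have "z \<longlonglongrightarrow> s"
    by (rule tendsto_sandwich[rotated 3])
      (auto intro!: always_eventually le less_imp_le[OF gt] simp del: of_nat_Suc)
  then have "filterlim z (at_right s) sequentially"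
    unfolding filterlim_at using gt by (auto simp: less_imp_neq[symmetric])
  then show "filterlim (\<lambda>j. (of_int \<lfloor>s * real (Suc j)\<rfloor> + 1) / real (Suc j)) (at_right s) sequentially"
    unfolding z_def .
qed

lemma initial_segment_of_nat:
  assumes fin: "finite S" and S1: "S \<subseteq> {1..}" and down: "\<And>n. 1 \<le> n \<Longrightarrow> Suc n \<in> S \<Longrightarrow> n \<in> S"
  shows "S = {1..card S}"
proof (cases "S = {}")
  case False
  have "n \<in> S" if "1 \<le> n" "n \<le> Max S" for n
    using that(2,1)
  proof (induction rule: inc_induct)
    case base
    then show ?case using fin False by simp
  next
    case (step m)
    then have "Suc m \<in> S" by simp
    then show ?case using step by (intro down[of m])
  qed
  then have "S = {1..Max S}"
    using S1 fin by auto
  then show ?thesis by (metis card_atLeastAtMost diff_Suc_1)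
qed simp

lemma le_one_plus_square: "x \<le> 1 + x\<^sup>2" for x :: real
proof -
  have "0 \<le> (x - 1)\<^sup>2 + (x\<^sup>2 + 1)" by (intro add_nonneg_nonneg) simp_all
  then show ?thesis by (simp add: power2_diff)
qed

section \<open>From integral equations to linear differential equations\<close>

lemma has_derivative_of_integral_equation:
  fixes h v :: "real \<Rightarrow> real"
  assumes v: "\<And>t. 0 \<le> t \<Longrightarrow> v t = c + (LINT s:{0..t}|lborel. h s)"
    and h: "continuous_on {0..} h" and t: "0 \<le> t"
  shows "(v has_real_derivative h t) (at t within {0..})"
proof -
  have i: "set_integrable lborel {0..u} h" for u
    by (intro borel_integrable_atLeastAtMost' continuous_on_subset[OF h]) auto
  have eq: "v u = c + integral {0..u} h" if "0 \<le> u" for u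
    using v[OF that] set_borel_integral_eq_integral(2)[OF i] by simp
  have "((\<lambda>u. integral {0..u} h) has_vector_derivative h t) (at t within {0..t + 1})"
    using t by (intro integral_has_vector_derivative continuous_on_subset[OF h]) auto
  then have "((\<lambda>u. integral {0..u} h) has_real_derivative h t) (at t within {0..t + 1})"
    by (simp add: has_real_derivative_iff_has_vector_derivative)
  then have "((\<lambda>u. c + integral {0..u} h) has_real_derivative h t) (at t within {0..t + 1})"
    by (auto intro!: derivative_eq_intros)
  moreover have "at t within {0..t + 1} = at t within {0..}"
    by (rule at_within_nhd[of t "{t - 1<..<t + 1}"]) auto
  ultimately have "((\<lambda>u. c + integral {0..u} h) has_real_derivative h t) (at t within {0..})"
    by simp
  then show ?thesis
    by (rule has_field_derivative_transform_within[of _ _ _ _ 1]) (use t eq in auto)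
qed

text \<open>First half of a bootstrap: the moments are known only to be integrable in time. Their
  integral equations make them continuous, which is what
  \<open>has_derivative_of_integral_equation\<close> asks of the integrand.\<close>

lemma continuous_on_of_integral_equation:
  fixes h v :: "real \<Rightarrow> real"
  assumes v: "\<And>t. 0 \<le> t \<Longrightarrow> v t = c + (LINT s:{0..t}|lborel. h s)"
    and h: "\<And>t. 0 \<le> t \<Longrightarrow> set_integrable lborel {0..t} h"
  shows "continuous_on {0..} v"
  unfolding continuous_on_eq_continuous_within
proof
  fix t :: real assume t: "t \<in> {0..}"
  have "continuous_on {0..t + 1} (\<lambda>u. c + integral {0..u} h)"
    using set_borel_integral_eq_integral(1)[OF h[of "t + 1"]] t
    by (intro continuous_intros indefinite_integral_continuous_1) simp
  moreover have "v u = c + integral {0..u} h" if "u \<in> {0..t + 1}" for u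
    using v[of u] set_borel_integral_eq_integral(2)[OF h[of u]] that by simp
  ultimately have "continuous_on {0..t + 1} v"
    by (subst continuous_on_cong[OF refl]) auto
  then have "continuous (at t within {0..t + 1}) v"
    using t by (simp add: continuous_on_eq_continuous_within)
  moreover have "at t within {0..t + 1} = at t within {0..}"
    by (rule at_within_nhd[of t "{t - 1<..<t + 1}"]) auto
  ultimately show "continuous (at t within {0..}) v" by (simp add: continuous_within)
qed

text \<open>The integrating factor \<open>exp (- r * t)\<close> makes the weighted difference
  constant. With uniqueness at hand a closed form need only be checked, not derived.\<close>

lemma linear_ode_unique:
  fixes u v g :: "real \<Rightarrow> real"
  assumes u: "\<And>t. 0 \<le> t \<Longrightarrow> (u has_real_derivative g t + r * u t) (at t within {0..})"
    and v: "\<And>t. 0 \<le> t \<Longrightarrow> (v has_real_derivative g t + r * v t) (at t within {0..})"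
    and "u 0 = v 0" and t: "0 \<le> t"
  shows "u t = v t"
proof -
  have "((\<lambda>t. exp (- r * t) * (u t - v t)) has_real_derivative 0) (at t within {0..})" if "t \<in> {0..}" for t
    using that by (auto intro!: derivative_eq_intros u v simp: algebra_simps)
  then obtain c where c: "\<And>t. t \<in> {0..} \<Longrightarrow> exp (- r * t) * (u t - v t) = c"
    using has_field_derivative_zero_constant[of "{0..}" "\<lambda>t. exp (- r * t) * (u t - v t)"] by auto
  then show ?thesis using c[of 0] c[of t] t \<open>u 0 = v 0\<close> by simp
qed

context linear_self_exciting
begin

subsection \<open>Predictable processes\<close>

abbreviation Pred :: "(real \<times> 'a) measure" where
  "Pred \<equiv> predictable_sigma (space M) F"

lemma sets_F_subset: "sets (F t) \<subseteq> sets M"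
  using sub[of t] by (simp add: subalgebra_def)

lemma lam_adapted: "0 \<le> t \<Longrightarrow> lam t \<in> borel_measurable (F (ennreal t))"
  using intensity by (simp add: has_intensity_def)

lemma lam_measurable: "0 \<le> t \<Longrightarrow> lam t \<in> borel_measurable M"
  using measurable_from_subalg[OF sub lam_adapted] .

lemma lam_cadlag: "\<omega> \<in> space M \<Longrightarrow> cadlag_path (\<lambda>t. lam t \<omega>)"
  and lam_nonneg: "\<omega> \<in> space M \<Longrightarrow> 0 \<le> t \<Longrightarrow> 0 \<le> lam t \<omega>"
  using intensity by (auto simp: has_intensity_def)

lemma intensity_formula:
  "f \<in> borel_measurable Pred \<Longrightarrow>
    (\<integral>\<^sup>+\<omega>. (\<integral>\<^sup>+s\<in>{0..}. f (s, \<omega>) \<partial>jump_measure T \<omega>) \<partial>M) =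
    (\<integral>\<^sup>+\<omega>. (\<integral>\<^sup>+s\<in>{0..}. f (s, \<omega>) * ennreal (lam s \<omega>) \<partial>lborel) \<partial>M)"
  using intensity by (simp add: has_intensity_def)

lemma Pred_generators:
  "{{0} \<times> A | A. A \<in> sets (F 0)} \<union>
    {{s<..t} \<times> A | s t A. 0 \<le> s \<and> s \<le> t \<and> A \<in> sets (F (ennreal s))} \<subseteq> Pow ({0..} \<times> space M)"
proof -
  have "A \<subseteq> space M" if "A \<in> sets (F s)" for A s
    using sets.sets_into_space[OF that] space_F[of s] by simp
  then show ?thesis by fastforce
qed

lemma space_Pred: "space Pred = {0..} \<times> space M"
  unfolding predictable_sigma_def by (rule space_measure_of[OF Pred_generators])

lemma sets_Pred: "sets Pred = sigma_sets ({0..} \<times> space M) ({{0} \<times> A | A. A \<in> sets (F 0)} \<union>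
    {{s<..t} \<times> A | s t A. 0 \<le> s \<and> s \<le> t \<and> A \<in> sets (F (ennreal s))})"
  unfolding predictable_sigma_def by (rule sets_measure_of[OF Pred_generators])

lemma Pred_zero: "A \<in> sets (F 0) \<Longrightarrow> {0} \<times> A \<in> sets Pred"
  unfolding sets_Pred by (intro sigma_sets.Basic) auto

lemma Pred_Ioc: "0 \<le> s \<Longrightarrow> A \<in> sets (F (ennreal s)) \<Longrightarrow> {s<..t} \<times> A \<in> sets Pred"
proof (cases "s \<le> t")
  case True
  then show "0 \<le> s \<Longrightarrow> A \<in> sets (F (ennreal s)) \<Longrightarrow> {s<..t} \<times> A \<in> sets Pred"
    unfolding sets_Pred by (intro sigma_sets.Basic) auto
qed simp

lemma Pred_Ioi: "0 \<le> s \<Longrightarrow> A \<in> sets (F (ennreal s)) \<Longrightarrow> {s<..} \<times> A \<in> sets Pred"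
proof -
  assume *: "0 \<le> s" "A \<in> sets (F (ennreal s))"
  have "{s<..} \<times> A = (\<Union>n::nat. {s<..s + real n} \<times> A)"
  proof -
    have "\<exists>n::nat. x \<le> s + real n" for x
      using real_arch_simple[of "x - s"] by (auto simp: algebra_simps)
    then show ?thesis by auto
  qed
  also have "\<dots> \<in> sets Pred"
    using * by (intro sets.countable_UN) (auto intro: Pred_Ioc)
  finally show ?thesis .
qed

lemma Pred_subset_product: "sets Pred \<subseteq> sets (borel \<Otimes>\<^sub>M M)"
  unfolding sets_Pred
  by (rule sets.sigma_sets_subset') (use sets_F_subset in \<open>auto intro!: pair_measureI\<close>)

text \<open>\<open>Pred\<close> has the half line times \<open>space M\<close> as its space, whereas
  Lebesgue measure lives on the whole line. Extension by 0 carries predictable functions over to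
  where Fubini applies.\<close>

lemma borel_measurable_Pred_product:
  fixes f :: "real \<times> 'a \<Rightarrow> ennreal"
  assumes "f \<in> borel_measurable Pred"
  shows "(\<lambda>x. f x * indicator ({0..} \<times> space M) x) \<in> borel_measurable (borel \<Otimes>\<^sub>M M)"
proof -
  have S: "{0::real..} \<times> space M \<in> sets (borel \<Otimes>\<^sub>M M)" by (auto intro!: pair_measureI)
  have "f \<in> borel_measurable (restrict_space (borel \<Otimes>\<^sub>M M) ({0..} \<times> space M))"
  proof (rule measurableI)
    fix A :: "ennreal set" assume "A \<in> sets borel"
    then have "f -` A \<inter> space Pred \<in> sets (borel \<Otimes>\<^sub>M M)"
      using measurable_sets[OF assms] Pred_subset_product by blast
    moreover have "space (restrict_space (borel \<Otimes>\<^sub>M M) ({0..} \<times> space M)) = space Pred"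
      by (auto simp: space_restrict_space space_pair_measure space_Pred)
    ultimately show "f -` A \<inter> space (restrict_space (borel \<Otimes>\<^sub>M M) ({0..} \<times> space M))
        \<in> sets (restrict_space (borel \<Otimes>\<^sub>M M) ({0..} \<times> space M))"
      using S by (simp add: sets_restrict_space_iff space_Pred)
  qed simp
  then show ?thesis
    using borel_measurable_restrict_space_iff_ennreal[of "{0..} \<times> space M" "borel \<Otimes>\<^sub>M M" f] S
    by (simp add: space_pair_measure Int_absorb2 Times_subset_cancel2)
qed

lemma borel_measurable_Pred_section:
  fixes f :: "real \<times> 'a \<Rightarrow> ennreal"
  assumes "f \<in> borel_measurable Pred" "\<omega> \<in> space M"
  shows "(\<lambda>s. f (s, \<omega>) * indicator {0..} s) \<in> borel_measurable borel"
proof -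
  have "(\<lambda>s. f (s, \<omega>) * indicator ({0..} \<times> space M) (s, \<omega>)) \<in> borel_measurable borel"
    by (rule measurable_compose[OF _ borel_measurable_Pred_product[OF assms(1)]]) (use assms(2) in measurable)
  then show ?thesis using assms(2) by (simp add: indicator_times)
qed

lemma fst_Pred [measurable]: "fst \<in> borel_measurable Pred"
  unfolding borel_measurable_iff_greater
proof
  fix a :: real
  have "{w \<in> space Pred. a < fst w} = (if 0 \<le> a then {a<..} \<times> space M else space Pred)"
    by (auto simp: space_Pred)
  moreover have "space M \<in> sets (F (ennreal a))"
    using sets.top[of "F (ennreal a)"] space_F by simp
  ultimately show "{w \<in> space Pred. a < fst w} \<in> sets Pred"
    using Pred_Ioi[of a "space M"] by auto
qed

text \<open>Information available at \<open>q\<close> may be used strictly after \<open>q\<close>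
  only. These frozen values, with \<open>Pred_initial\<close> for time 0, are the blocks from which
  \<open>lam_left\<close> is assembled.\<close>

lemma Pred_after:
  assumes q: "0 \<le> q" and Z: "Z \<in> borel_measurable (F (ennreal q))"
  shows "(\<lambda>w. if q < fst w then Z (snd w) else (0::real)) \<in> borel_measurable Pred"
proof (rule measurableI)
  fix B :: "real set" assume B: "B \<in> sets borel"
  have "Z -` B \<inter> space M \<in> sets (F (ennreal q))"
    using measurable_sets[OF Z B] by (simp add: space_F)
  then have "{q<..} \<times> (Z -` B \<inter> space M) \<in> sets Pred" by (rule Pred_Ioi[OF q])
  moreover have "{w\<in>space Pred. fst w \<le> q} \<in> sets Pred" by measurable
  moreover have "(\<lambda>w. if q < fst w then Z (snd w) else 0) -` B \<inter> space Pred =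
     {q<..} \<times> (Z -` B \<inter> space M) \<union> (if 0 \<in> B then {w\<in>space Pred. fst w \<le> q} else {})"
    using q by (auto simp: space_Pred split: if_splits)
  ultimately show "(\<lambda>w. if q < fst w then Z (snd w) else 0) -` B \<inter> space Pred \<in> sets Pred"
    by auto
qed simp

lemma Pred_initial:
  assumes Z: "Z \<in> borel_measurable (F 0)"
  shows "(\<lambda>w. Z (snd w) :: real) \<in> borel_measurable Pred"
proof (rule measurableI)
  fix B :: "real set" assume B: "B \<in> sets borel"
  have "Z -` B \<inter> space M \<in> sets (F 0)"
    using measurable_sets[OF Z B] by (simp add: space_F)
  then have "{0} \<times> (Z -` B \<inter> space M) \<in> sets Pred" "{0<..} \<times> (Z -` B \<inter> space M) \<in> sets Pred"
    using Pred_zero Pred_Ioi[of 0] by auto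
  moreover have "(\<lambda>w. Z (snd w)) -` B \<inter> space Pred =
     {0} \<times> (Z -` B \<inter> space M) \<union> {0<..} \<times> (Z -` B \<inter> space M)"
    by (auto simp: space_Pred)
  ultimately show "(\<lambda>w. Z (snd w)) -` B \<inter> space Pred \<in> sets Pred"
    by auto
qed simp

text \<open>Limits along a grid to the left of \<open>fst w\<close> make predictability evident; the value at time 0 is \<open>lam 0\<close>.\<close>

definition lam_left :: "real \<times> 'a \<Rightarrow> real" where
  "lam_left w = lim (\<lambda>j. lam (max 0 ((of_int \<lceil>fst w * real (Suc j)\<rceil> - 1) / real (Suc j))) (snd w))"

lemma lam_left_Pred [measurable]: "lam_left \<in> borel_measurable Pred"
proof -
  have "(\<lambda>w. lam (max 0 ((of_int \<lceil>fst w * real (Suc j)\<rceil> - 1) / real (Suc j))) (snd w)) \<in> borel_measurable Pred" for j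
  proof -
    define q where "q i = max 0 ((of_int i - 1) / real (Suc j))" for i :: int
    \<comment> \<open>At the index inserted below, the grid point \<open>q i\<close> lies strictly
      before \<open>fst w\<close> unless \<open>fst w = 0\<close>. The second summand is thus active
      at time 0 only, where \<open>q 0 = 0\<close> and the value \<open>lam 0\<close> is already
      known.\<close>
    define f where "f i w = (if q i < fst w then lam (q i) (snd w) else 0) +
        (if q i < fst w then 0 else lam 0 (snd w))" for i and w :: "real \<times> 'a"
    have [measurable]: "f i \<in> borel_measurable Pred" for i
    proof -
      have "(\<lambda>w. lam 0 (snd w)) \<in> borel_measurable Pred"
        using Pred_initial lam_adapted[of 0] by simp
      moreover have "(\<lambda>w. if q i < fst w then lam (q i) (snd w) else 0) \<in> borel_measurable Pred"
        by (intro Pred_after lam_adapted) (auto simp: q_def)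
      ultimately show ?thesis unfolding f_def by measurable
    qed
    have "(\<lambda>w. f \<lceil>fst w * real (Suc j)\<rceil> w) \<in> borel_measurable Pred"
      by (rule measurable_compose_countable) measurable
    then show ?thesis
    proof (rule measurable_cong[THEN iffD1, rotated])
      fix w assume w: "w \<in> space Pred"
      have "q \<lceil>fst w * real (Suc j)\<rceil> < fst w" if "0 < fst w"
      proof -
        have "(of_int \<lceil>fst w * real (Suc j)\<rceil> - 1) / real (Suc j) < fst w"
          by (subst pos_divide_less_eq) (simp, linarith)
        then show ?thesis using that by (simp add: q_def)
      qed
      moreover have "q 0 = 0" by (simp add: q_def)
      ultimately show "f \<lceil>fst w * real (Suc j)\<rceil> w =
          lam (max 0 ((of_int \<lceil>fst w * real (Suc j)\<rceil> - 1) / real (Suc j))) (snd w)"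
        using w unfolding q_def[symmetric] by (cases "fst w = 0") (auto simp: f_def space_Pred)
    qed
  qed
  then show ?thesis
    unfolding lam_left_def[abs_def] by (rule borel_measurable_lim_metric)
qed

lemma lam_left_eq:
  assumes "0 < s" and lim: "((\<lambda>u. lam u \<omega>) \<longlongrightarrow> y) (at_left s)"
  shows "lam_left (s, \<omega>) = y"
proof -
  have "((\<lambda>u. lam (max 0 u) \<omega>) \<longlongrightarrow> y) (at_left s)"
  proof (rule Lim_transform_eventually[OF lim])
    have "eventually (\<lambda>u. u \<in> {0<..<s}) (at_left s)"
      by (rule eventually_at_left_real[OF \<open>0 < s\<close>])
    then show "eventually (\<lambda>u. lam u \<omega> = lam (max 0 u) \<omega>) (at_left s)"
      by eventually_elim auto
  qed
  from tendsto_at_left_grid[OF this] show ?thesis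
    unfolding lam_left_def fst_conv snd_conv by (rule limI)
qed

text \<open>Right continuity makes the process a limit of its values at grid points just after the
  current time. Such values look into the future, so this gives measurability for Fubini but not
  predictability.\<close>

lemma lam_joint: "(\<lambda>w. lam (max 0 (fst w)) (snd w)) \<in> borel_measurable (borel \<Otimes>\<^sub>M M)"
proof (rule borel_measurable_LIMSEQ_metric)
  fix j
  define f where "f i w = lam (max 0 ((of_int i + 1) / real (Suc j))) (snd w)" for i and w :: "real \<times> 'a"
  have [measurable]: "f i \<in> borel_measurable (borel \<Otimes>\<^sub>M M)" for i
    unfolding f_def by (rule measurable_compose[OF measurable_snd lam_measurable]) simp
  have "(\<lambda>w. f \<lfloor>max 0 (fst w) * real (Suc j)\<rfloor> w) \<in> borel_measurable (borel \<Otimes>\<^sub>M M)"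
    by (rule measurable_compose_countable[where f = f]) measurable
  then
  show "(\<lambda>w. lam (max 0 ((of_int \<lfloor>max 0 (fst w) * real (Suc j)\<rfloor> + 1) / real (Suc j))) (snd w)) \<in> borel_measurable (borel \<Otimes>\<^sub>M M)"
    unfolding f_def .
next
  fix w :: "real \<times> 'a" assume "w \<in> space (borel \<Otimes>\<^sub>M M)"
  then have "((\<lambda>u. lam u (snd w)) \<longlongrightarrow> lam (max 0 (fst w)) (snd w)) (at_right (max 0 (fst w)))"
    using lam_cadlag[of "snd w"] by (auto simp: cadlag_path_def space_pair_measure)
  from tendsto_at_right_grid[OF this]
  have "(\<lambda>j. lam ((of_int \<lfloor>max 0 (fst w) * real (Suc j)\<rfloor> + 1) / real (Suc j)) (snd w))
      \<longlonglongrightarrow> lam (max 0 (fst w)) (snd w)" .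
  moreover have "max 0 ((of_int \<lfloor>max 0 (fst w) * real (Suc j)\<rfloor> + 1) / real (Suc j)) =
      (of_int \<lfloor>max 0 (fst w) * real (Suc j)\<rfloor> + 1 :: real) / real (Suc j)" for j
  proof -
    have "0 \<le> \<lfloor>max 0 (fst w) * real (Suc j)\<rfloor>" by simp
    then show ?thesis by (intro max_absorb2 divide_nonneg_nonneg) auto
  qed
  ultimately show "(\<lambda>j. lam (max 0 ((of_int \<lfloor>max 0 (fst w) * real (Suc j)\<rfloor> + 1) / real (Suc j))) (snd w))
      \<longlonglongrightarrow> lam (max 0 (fst w)) (snd w)"
    by (simp only:)
qed

text \<open>By right continuity the rational times suffice, which makes this set a countable combination of
  predictable rectangles.\<close>

definition below :: "real \<Rightarrow> (real \<times> 'a) set" where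
  "below k = {(s, \<omega>). 0 \<le> s \<and> \<omega> \<in> space M \<and> (\<forall>q\<in>\<rat>. 0 \<le> q \<and> q < s \<longrightarrow> lam q \<omega> \<le> k)}"

lemma below_Pred: "below k \<in> sets Pred"
proof -
  have "{w \<in> space M. k < lam q w} \<in> sets (F (ennreal q))" if "0 \<le> q" for q
  proof -
    note [measurable] = lam_adapted[OF that]
    have "{w \<in> space (F (ennreal q)). k < lam q w} \<in> sets (F (ennreal q))" by measurable
    then show ?thesis by (simp add: space_F)
  qed
  then have "(\<Union>q\<in>\<rat> \<inter> {0..}. {q<..} \<times> {w\<in>space M. k < lam q w}) \<in> sets Pred"
    by (intro sets.countable_UN'' countable_Int1 countable_rat Pred_Ioi) auto
  moreover have "(s, \<omega>) \<in> below k \<longleftrightarrow>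
      (s, \<omega>) \<in> space Pred - (\<Union>q\<in>\<rat> \<inter> {0..}. {q<..} \<times> {w\<in>space M. k < lam q w})" for s \<omega>
    by (auto simp only: below_def space_Pred not_less[symmetric] mem_Collect_eq case_prod_conv
        Diff_iff UN_iff mem_Times_iff fst_conv snd_conv greaterThan_iff Int_iff atLeast_iff)
  then have "below k = space Pred - (\<Union>q\<in>\<rat> \<inter> {0..}. {q<..} \<times> {w\<in>space M. k < lam q w})"
    by (intro set_eqI) (simp only: split_paired_all)
  ultimately show ?thesis by (simp only: sets.compl_sets)
qed

lemma below_antimono: "(t, \<omega>) \<in> below k \<Longrightarrow> 0 \<le> s \<Longrightarrow> s \<le> t \<Longrightarrow> (s, \<omega>) \<in> below k"
  by (auto simp: below_def)

lemma below_le: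
  assumes "(t, \<omega>) \<in> below k" "0 \<le> s" "s < t"
  shows "lam s \<omega> \<le> k"
proof (rule ccontr)
  assume "\<not> lam s \<omega> \<le> k"
  moreover have "((\<lambda>u. lam u \<omega>) \<longlongrightarrow> lam s \<omega>) (at_right s)"
    using assms lam_cadlag[of \<omega>] by (auto simp: below_def cadlag_path_def)
  ultimately have "eventually (\<lambda>u. k < lam u \<omega>) (at_right s)"
    by (intro order_tendstoD) auto
  then obtain b where b: "s < b" "\<And>u. s < u \<Longrightarrow> u < b \<Longrightarrow> k < lam u \<omega>"
    unfolding eventually_at_right_field by blast
  obtain q where "q \<in> \<rat>" "s < q" "q < min b t"
    using Rats_dense_in_real[of s "min b t"] b(1) assms(3) by auto
  then show False
    using b(2)[of q] assms unfolding below_def by fastforce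
qed

text \<open>A cadlag path is bounded on \<open>{0..t}\<close>, so the first passages above
  \<open>k\<close> leave every bounded time interval as \<open>k\<close> grows. This is what removes
  the stopping in the limit.\<close>

lemma eventually_below:
  assumes "\<omega> \<in> space M" "0 \<le> t"
  shows "eventually (\<lambda>k::nat. (t, \<omega>) \<in> below k) sequentially"
proof -
  obtain K where K: "\<forall>s\<in>{0..t}. \<bar>lam s \<omega>\<bar> \<le> K"
    using cadlag_path_bounded[OF lam_cadlag[OF assms(1)] assms(2)] by blast
  have "(t, \<omega>) \<in> below k" if "nat \<lceil>K\<rceil> \<le> k" for k :: nat
  proof -
    have "K \<le> k" using that by linarith
    then show ?thesis using K assms unfolding below_def by force
  qed
  then show ?thesis unfolding eventually_sequentially by blast
qed

subsection \<open>Campbell's formula for the marked point process\<close>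

lemma T_measurable:
  assumes "1 \<le> n"
  shows "T n \<in> borel_measurable M"
proof (rule borel_measurableI_le)
  fix t
  have "Measurable.pred (F t) (\<lambda>\<omega>. T n \<omega> \<le> t)"
    using event_times[OF assms] by (simp add: stopping_time_def)
  then have "{\<omega>\<in>space M. T n \<omega> \<le> t} \<in> sets (F t)"
    by (simp add: pred_def space_F)
  then show "{\<omega>\<in>space M. T n \<omega> \<le> t} \<in> sets M" using sets_F_subset by auto
qed

lemma Xs_measurable [measurable]: "1 \<le> n \<Longrightarrow> Xs n \<in> borel_measurable M"
  using jumps_indep by (auto simp: indep_vars_def)

lemma strict_past_generators:
  "sets (F 0) \<union> {{\<omega> \<in> A. t < \<tau> \<omega>} | t A. A \<in> sets (F t)} \<subseteq> Pow (space M)"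
proof -
  have "A \<subseteq> space M" if "A \<in> sets (F s)" for A s
    using sets.sets_into_space[OF that] space_F[of s] by simp
  then show ?thesis by fastforce
qed

lemma space_strict_past: "space (strict_past (space M) F \<tau>) = space M"
  unfolding strict_past_def by (rule space_measure_of[OF strict_past_generators])

lemma sets_strict_past: "sets (strict_past (space M) F \<tau>) =
    sigma_sets (space M) (sets (F 0) \<union> {{\<omega> \<in> A. t < \<tau> \<omega>} | t A. A \<in> sets (F t)})"
  unfolding strict_past_def by (rule sets_measure_of[OF strict_past_generators])

lemma strict_past_initial: "A \<in> sets (F 0) \<Longrightarrow> A \<in> sets (strict_past (space M) F \<tau>)"
  unfolding sets_strict_past by (intro sigma_sets.Basic) auto

lemma strict_past_before: "A \<in> sets (F t) \<Longrightarrow> {\<omega> \<in> A. t < \<tau> \<omega>} \<in> sets (strict_past (space M) F \<tau>)"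
  unfolding sets_strict_past by (intro sigma_sets.Basic) auto

lemma strict_past_finite: "{\<omega>\<in>space M. \<tau> \<omega> < \<infinity>} \<in> sets (strict_past (space M) F \<tau>)"
proof -
  have "{\<omega>\<in>space M. \<tau> \<omega> < \<infinity>} = space M - (\<Inter>k::nat. {\<omega>\<in>space M. of_nat k < \<tau> \<omega>})"
  proof -
    have "x < \<infinity> \<longleftrightarrow> (\<exists>k::nat. \<not> of_nat k < x)" for x :: ennreal
    proof
      assume "x < \<infinity>"
      then obtain k :: nat where "x < of_nat k" using ennreal_Ex_less_of_nat by auto
      then show "\<exists>k::nat. \<not> of_nat k < x" by (intro exI[of _ k]) (simp add: not_less less_imp_le)
    next
      assume "\<exists>k::nat. \<not> of_nat k < x"
      then obtain k :: nat where "x \<le> of_nat k" by (auto simp: not_less)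
      also have "of_nat k < (\<infinity> :: ennreal)" by (simp add: of_nat_less_top)
      finally show "x < \<infinity>" .
    qed
    then show ?thesis by blast
  qed
  moreover have "(\<Inter>k::nat. {\<omega>\<in>space M. of_nat k < \<tau> \<omega>}) \<in> sets (strict_past (space M) F \<tau>)"
  proof -
    have "space M \<in> sets (F t)" for t using sets.top[of "F t"] by (simp add: space_F)
    then have "{\<omega>\<in>space M. of_nat k < \<tau> \<omega>} \<in> sets (strict_past (space M) F \<tau>)" for k :: nat
      by (rule strict_past_before)
    then show ?thesis by (intro sets.countable_INT) auto
  qed
  moreover have "space M \<in> sets (strict_past (space M) F \<tau>)"
    by (metis sets.top space_strict_past)
  ultimately show ?thesis by (simp add: sets.Diff)
qed

lemma sets_strict_past_subset:
  assumes "1 \<le> n"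
  shows "sets (strict_past (space M) F (T n)) \<subseteq> sets M"
proof -
  note [measurable] = T_measurable[OF assms]
  have "{\<omega>\<in>A. t < T n \<omega>} \<in> sets M" if "A \<in> sets (F t)" for A t
  proof -
    have [measurable]: "A \<in> sets M" using that sets_F_subset by auto
    have "{\<omega>\<in>A. t < T n \<omega>} = A \<inter> {\<omega>\<in>space M. t < T n \<omega>}"
      using sets.sets_into_space[OF \<open>A \<in> sets M\<close>] by auto
    then show ?thesis by simp
  qed
  then show ?thesis
    unfolding sets_strict_past using sets_F_subset by (intro sets.sigma_sets_subset) auto
qed

text \<open>The value 0 at index 0 and at events that never occur lets series range over all of
  \<open>nat\<close>.\<close>

definition at_event :: "(real \<times> 'a \<Rightarrow> 'b::zero) \<Rightarrow> nat \<Rightarrow> 'a \<Rightarrow> 'b" where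
  "at_event f n \<omega> = (if 1 \<le> n \<and> T n \<omega> < \<infinity> then f (enn2real (T n \<omega>), \<omega>) else 0)"

text \<open>It suffices to pull back the generators of \<open>Pred\<close> along
  \<open>\<omega> \<mapsto> (T n \<omega>, \<omega>)\<close>. The rectangle
  \<open>{s<..t} \<times> A\<close> becomes the difference of
  \<open>{\<omega>\<in>A. s < T n \<omega>}\<close> and
  \<open>{\<omega>\<in>A. t < T n \<omega>}\<close>; both are generators of the strict past, since
  \<open>A\<close> is known at \<open>s\<close> and hence at \<open>t\<close>.\<close>

lemma at_event_strict_past:
  fixes f :: "real \<times> 'a \<Rightarrow> ennreal"
  assumes n: "1 \<le> n" and f: "f \<in> borel_measurable Pred"
  shows "at_event f n \<in> borel_measurable (strict_past (space M) F (T n))"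
proof -
  define S where "S = strict_past (space M) F (T n)"
  define D where "D = {\<omega>\<in>space M. T n \<omega> < \<infinity>}"
  have D: "D \<in> sets S" unfolding D_def S_def by (rule strict_past_finite)
  have sp: "space S = space M" unfolding S_def by (rule space_strict_past)
  have DM: "D \<subseteq> space M" by (auto simp: D_def)
  have spR: "space (restrict_space S D) = D"
    using DM by (auto simp: space_restrict_space sp)
  have restr: "B \<in> sets (restrict_space S D)" if "B \<in> sets S" "B \<subseteq> D" for B
    using that D by (subst sets_restrict_space_iff) (auto simp: sp DM Int_absorb2)
  let ?\<phi> = "\<lambda>\<omega>. (enn2real (T n \<omega>), \<omega>)"
  have \<phi>: "?\<phi> \<in> measurable (restrict_space S D) Pred"
    unfolding predictable_sigma_def
  proof (rule measurable_measure_of[OF Pred_generators])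
    show "?\<phi> \<in> space (restrict_space S D) \<rightarrow> {0..} \<times> space M"
      using DM by (auto simp: spR)
    have lt: "s < enn2real x \<longleftrightarrow> ennreal s < x" if "0 \<le> s" "x < \<infinity>" for s :: real and x
      using that by (cases x) (auto simp: ennreal_less_iff)
    fix y assume "y \<in> {{0} \<times> A | A. A \<in> sets (F 0)} \<union>
      {{s<..t} \<times> A | s t A. 0 \<le> s \<and> s \<le> t \<and> A \<in> sets (F (ennreal s))}"
    then show "?\<phi> -` y \<inter> space (restrict_space S D) \<in> sets (restrict_space S D)"
    proof (elim UnE CollectE exE conjE)
      fix A assume y: "y = {0} \<times> A" and A: "A \<in> sets (F 0)"
      have "?\<phi> -` y \<inter> D = (A - {\<omega>\<in>A. 0 < T n \<omega>}) \<inter> D"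
        using DM by (auto simp: y D_def enn2real_eq_0_iff)
      also have "\<dots> \<in> sets (restrict_space S D)"
        using strict_past_initial[OF A] strict_past_before[OF A] D
        by (intro restr) (auto simp: S_def)
      finally show ?thesis by (simp add: spR)
    next
      fix s t A assume y: "y = {s<..t} \<times> A" and st: "0 \<le> s" "s \<le> t" and A: "A \<in> sets (F (ennreal s))"
      have A': "A \<in> sets (F (ennreal t))" using A sets_F_mono[of "ennreal s" "ennreal t"] st by (auto simp: ennreal_leI)
      have "?\<phi> -` y \<inter> D = ({\<omega>\<in>A. ennreal s < T n \<omega>} - {\<omega>\<in>A. ennreal t < T n \<omega>}) \<inter> D"
        using st lt by (auto simp: y D_def not_less[symmetric])
      also have "\<dots> \<in> sets (restrict_space S D)"
        using strict_past_before[OF A] strict_past_before[OF A'] D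
        by (intro restr) (auto simp: S_def)
      finally show ?thesis by (simp add: spR)
    qed
  qed
  have "(\<lambda>\<omega>. f (?\<phi> \<omega>)) \<in> borel_measurable (restrict_space S D)"
    by (rule measurable_compose[OF \<phi> f])
  then have "(\<lambda>\<omega>. f (?\<phi> \<omega>) * indicator D \<omega>) \<in> borel_measurable S"
    using D by (subst (asm) borel_measurable_restrict_space_iff_ennreal) (auto simp: sp DM Int_absorb2)
  moreover have "at_event f n \<omega> = f (?\<phi> \<omega>) * indicator D \<omega>" if "\<omega> \<in> space S" for \<omega>
    using n that by (auto simp: at_event_def D_def sp)
  ultimately show ?thesis
    unfolding S_def[symmetric] by (simp cong: measurable_cong)
qed

lemma at_event_measurable:
  fixes f :: "real \<times> 'a \<Rightarrow> ennreal"
  assumes f: "f \<in> borel_measurable Pred"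
  shows "at_event f n \<in> borel_measurable M"
proof (cases "1 \<le> n")
  case True
  then have "subalgebra M (strict_past (space M) F (T n))"
    using sets_strict_past_subset by (simp add: subalgebra_def space_strict_past)
  then show ?thesis
    using at_event_strict_past[OF True f] by (rule measurable_from_subalg)
qed (simp add: at_event_def[abs_def])

lemma nn_integral_jump_measure:
  fixes f :: "real \<times> 'a \<Rightarrow> ennreal"
  assumes f: "f \<in> borel_measurable Pred" and \<omega>: "\<omega> \<in> space M"
  shows "(\<integral>\<^sup>+s\<in>{0..}. f (s, \<omega>) \<partial>jump_measure T \<omega>) = (\<Sum>n. at_event f n \<omega>)"
proof -
  let ?I = "{n. 1 \<le> n \<and> T n \<omega> < \<infinity>}"
  have "(\<integral>\<^sup>+s\<in>{0..}. f (s, \<omega>) \<partial>jump_measure T \<omega>) =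
      (\<integral>\<^sup>+n. f (enn2real (T n \<omega>), \<omega>) * indicator {0..} (enn2real (T n \<omega>)) \<partial>count_space ?I)"
    unfolding jump_measure_def
    by (rule nn_integral_distr) (auto intro: borel_measurable_Pred_section[OF f \<omega>])
  also have "\<dots> = (\<integral>\<^sup>+n. f (enn2real (T n \<omega>), \<omega>) * indicator ?I n \<partial>count_space UNIV)"
    by (subst nn_integral_count_space_indicator) auto
  also have "\<dots> = (\<Sum>n. at_event f n \<omega>)"
    by (subst nn_integral_count_space_nat) (auto simp: at_event_def intro!: suminf_cong)
  finally show ?thesis .
qed

text \<open>The first factor belongs to the strict past of \<open>T n\<close>, which is independent
  of \<open>Xs n\<close>; the joint law is a product and Tonelli separates the factors. Everything
  is non-negative, so no integrability is required.\<close>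

lemma nn_integral_mark:
  fixes f :: "real \<times> 'a \<Rightarrow> ennreal" and g :: "real \<Rightarrow> ennreal"
  assumes f: "f \<in> borel_measurable Pred" and g [measurable]: "g \<in> borel_measurable borel"
  shows "(\<integral>\<^sup>+\<omega>. at_event f n \<omega> * g (Xs n \<omega>) \<partial>M) = (\<integral>\<^sup>+\<omega>. at_event f n \<omega> \<partial>M) * (\<integral>\<^sup>+\<omega>. g (X \<omega>) \<partial>M)"
proof (cases "1 \<le> n")
  case True
  note [measurable] = Xs_measurable[OF True] at_event_measurable[OF f] X_rv
  define S where "S = strict_past (space M) F (T n)"
  let ?G = "\<lambda>\<omega>. g (Xs n \<omega>)"
  have "indep_set (sigma_sets (space M) {at_event f n -` A \<inter> space M | A. A \<in> sets borel})
        (sigma_sets (space M) {?G -` A \<inter> space M | A. A \<in> sets borel})"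
  proof -
    have gen: "{at_event f n -` A \<inter> space M | A. A \<in> sets borel} \<subseteq> sets S"
      using measurable_sets[OF at_event_strict_past[OF True f]] by (auto simp: S_def space_strict_past)
    have "sigma_sets (space M) {at_event f n -` A \<inter> space M | A. A \<in> sets borel} \<subseteq> sets S"
      using sets.sigma_sets_subset[OF gen] by (simp add: S_def space_strict_past)
    moreover have "sigma_sets (space M) {?G -` A \<inter> space M | A. A \<in> sets borel} \<subseteq>
        sets (vimage_algebra (space M) (Xs n) borel)"
    proof -
      have "?G -` A \<inter> space M \<in> sets (vimage_algebra (space M) (Xs n) borel)" if "A \<in> sets borel" for A
      proof -
        have "Xs n -` (g -` A) \<inter> space M \<in> sets (vimage_algebra (space M) (Xs n) borel)"
          using measurable_sets[OF g that] by (intro in_vimage_algebra) simp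
        then show ?thesis by (simp add: vimage_def)
      qed
      then have "{?G -` A \<inter> space M | A. A \<in> sets borel} \<subseteq> sets (vimage_algebra (space M) (Xs n) borel)"
        by auto
      from sets.sigma_sets_subset[OF this] show ?thesis by simp
    qed
    moreover have "indep_set (sets S) (sets (vimage_algebra (space M) (Xs n) borel))"
      unfolding S_def by (rule jumps_indep_past[OF True])
    ultimately show ?thesis
      unfolding indep_set_def by (elim indep_sets_mono_sets) (auto split: bool.split)
  qed
  then have "indep_var borel (at_event f n) borel ?G"
    unfolding indep_var_eq by (simp add: at_event_measurable[OF f])
  then have distr_eq: "distr M (borel \<Otimes>\<^sub>M borel) (\<lambda>\<omega>. (at_event f n \<omega>, ?G \<omega>)) =
      distr M borel (at_event f n) \<Otimes>\<^sub>M distr M borel ?G"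
    by (simp add: indep_var_distribution_eq)
  have "prob_space (distr M borel ?G)" by (rule prob_space_distr) measurable
  then interpret P2: prob_space "distr M borel ?G" .
  have "(\<integral>\<^sup>+\<omega>. at_event f n \<omega> * ?G \<omega> \<partial>M) =
      (\<integral>\<^sup>+w. fst w * snd w \<partial>distr M (borel \<Otimes>\<^sub>M borel) (\<lambda>\<omega>. (at_event f n \<omega>, ?G \<omega>)))"
    by (subst nn_integral_distr) auto
  also have "\<dots> = (\<integral>\<^sup>+a. (\<integral>\<^sup>+x. a * x \<partial>distr M borel ?G) \<partial>distr M borel (at_event f n))"
    unfolding distr_eq by (subst P2.nn_integral_fst[symmetric]) auto
  also have "\<dots> = (\<integral>\<^sup>+a. a \<partial>distr M borel (at_event f n)) * (\<integral>\<^sup>+x. x \<partial>distr M borel ?G)"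
    by (simp add: nn_integral_cmult nn_integral_multc)
  also have "\<dots> = (\<integral>\<^sup>+\<omega>. at_event f n \<omega> \<partial>M) * (\<integral>\<^sup>+x. g x \<partial>distr M borel (Xs n))"
    by (simp add: nn_integral_distr)
  also have "(\<integral>\<^sup>+x. g x \<partial>distr M borel (Xs n)) = (\<integral>\<^sup>+\<omega>. g (X \<omega>) \<partial>M)"
    unfolding jumps_law[OF True] by (simp add: nn_integral_distr)
  finally show ?thesis .
qed (simp add: at_event_def)

text \<open>All marks have the same law, so the factor of \<open>g\<close> is the same for every
  \<open>n\<close> and comes out of the series. What remains is the defining identity of the
  intensity for \<open>f\<close>.\<close>

lemma campbell_formula:
  fixes f :: "real \<times> 'a \<Rightarrow> ennreal" and g :: "real \<Rightarrow> ennreal"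
  assumes f: "f \<in> borel_measurable Pred" and g [measurable]: "g \<in> borel_measurable borel"
  shows "(\<integral>\<^sup>+\<omega>. (\<Sum>n. at_event f n \<omega> * g (Xs n \<omega>)) \<partial>M) =
     (\<integral>\<^sup>+\<omega>. (\<integral>\<^sup>+s\<in>{0..}. f (s, \<omega>) * ennreal (lam s \<omega>) \<partial>lborel) \<partial>M) * (\<integral>\<^sup>+\<omega>. g (X \<omega>) \<partial>M)"
proof -
  note [measurable] = at_event_measurable[OF f]
  \<comment> \<open>Nothing is known about \<open>Xs 0\<close>, but its factor
    \<open>at_event f 0\<close> vanishes.\<close>
  have [measurable]: "(\<lambda>\<omega>. at_event f n \<omega> * g (Xs n \<omega>)) \<in> borel_measurable M" for n
    by (cases "1 \<le> n") (auto simp: at_event_def[of f 0] not_le)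
  have "(\<integral>\<^sup>+\<omega>. (\<Sum>n. at_event f n \<omega> * g (Xs n \<omega>)) \<partial>M) = (\<Sum>n. (\<integral>\<^sup>+\<omega>. at_event f n \<omega> \<partial>M)) * (\<integral>\<^sup>+\<omega>. g (X \<omega>) \<partial>M)"
    by (simp add: nn_integral_suminf nn_integral_mark[OF f g])
  also have "(\<Sum>n. (\<integral>\<^sup>+\<omega>. at_event f n \<omega> \<partial>M)) = (\<integral>\<^sup>+\<omega>. (\<Sum>n. at_event f n \<omega>) \<partial>M)"
    by (simp add: nn_integral_suminf)
  also have "\<dots> = (\<integral>\<^sup>+\<omega>. (\<integral>\<^sup>+s\<in>{0..}. f (s, \<omega>) \<partial>jump_measure T \<omega>) \<partial>M)"
    by (intro nn_integral_cong) (simp add: nn_integral_jump_measure[OF f])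
  finally show ?thesis
    unfolding intensity_formula[OF f] .
qed

subsection \<open>Local finiteness of the events\<close>

definition arrivals :: "real \<Rightarrow> 'a \<Rightarrow> nat set" where
  "arrivals t \<omega> = {n. 1 \<le> n \<and> T n \<omega> \<le> ennreal t}"

lemma lam_section [measurable]:
  assumes "\<omega> \<in> space M"
  shows "(\<lambda>s. lam (max 0 s) \<omega>) \<in> borel_measurable borel"
proof -
  have "(\<lambda>s. (s, \<omega>)) \<in> measurable borel (borel \<Otimes>\<^sub>M M)"
    using assms by measurable
  from measurable_compose[OF this lam_joint] show ?thesis by simp
qed

text \<open>The level \<open>k\<close> is respected strictly before the first passage. Only at the
  last time of the section of \<open>below k\<close> may the path have jumped above it, so there is
  at most one exceptional time.\<close>

lemma AE_below:
  assumes "\<omega> \<in> space M"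
  shows "AE s in lborel. (s, \<omega>) \<in> below k \<longrightarrow> lam s \<omega> \<le> k"
proof (cases "\<exists>s. (s, \<omega>) \<in> below k \<and> k < lam s \<omega>")
  case True
  then obtain u where u: "(u, \<omega>) \<in> below k" "k < lam u \<omega>" by auto
  have "s = u" if "(s, \<omega>) \<in> below k" "k < lam s \<omega>" for s
  proof (rule ccontr)
    assume "s \<noteq> u"
    moreover have "0 \<le> s" "0 \<le> u" using that u by (auto simp: below_def)
    ultimately show False
      using below_le[of u \<omega> k s] below_le[of s \<omega> k u] u that by (cases s u rule: linorder_cases) auto
  qed
  then have *: "\<And>s. s \<noteq> u \<Longrightarrow> (s, \<omega>) \<in> below k \<longrightarrow> lam s \<omega> \<le> k" by force
  show ?thesis using AE_lborel_singleton[of u] by eventually_elim (rule *)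
qed (auto simp: not_less)

lemma AE_finite_arrivals_below:
  fixes i k :: nat
  shows "AE \<omega> in M. finite {n \<in> arrivals i \<omega>. (enn2real (T n \<omega>), \<omega>) \<in> below k}"
proof -
  define B where "B = below k \<inter> {w \<in> space Pred. fst w \<le> real i}"
  have B: "B \<in> sets Pred"
    unfolding B_def using below_Pred by (intro sets.Int) (auto, measurable)
  then have f: "indicator B \<in> borel_measurable Pred" by simp
  have "(\<integral>\<^sup>+\<omega>. (\<integral>\<^sup>+s\<in>{0..}. indicator B (s, \<omega>) * ennreal (lam s \<omega>) \<partial>lborel) \<partial>M) \<le>
      (\<integral>\<^sup>+\<omega>. (\<integral>\<^sup>+s. ennreal (real k) * indicator {0..real i} s \<partial>lborel) \<partial>M)"
  proof (rule nn_integral_mono, rule nn_integral_mono_AE)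
    fix \<omega> assume "\<omega> \<in> space M"
    then have "AE s in lborel. (s, \<omega>) \<in> below k \<longrightarrow> lam s \<omega> \<le> k" by (rule AE_below)
    then show "AE s in lborel. indicator B (s, \<omega>) * ennreal (lam s \<omega>) * indicator {0..} s \<le>
        ennreal (real k) * indicator {0..real i} s"
      by eventually_elim (auto simp: B_def space_Pred indicator_def intro!: ennreal_leI)
  qed
  also have "\<dots> = ennreal (real k) * ennreal (real i)"
    by (simp add: nn_integral_cmult emeasure_space_1)
  also have "\<dots> < \<infinity>" by (simp add: ennreal_mult_less_top)
  finally have "(\<integral>\<^sup>+\<omega>. (\<integral>\<^sup>+s\<in>{0..}. indicator B (s, \<omega>) \<partial>jump_measure T \<omega>) \<partial>M) \<noteq> \<infinity>"
    unfolding intensity_formula[OF f] by simp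
  also have "(\<integral>\<^sup>+\<omega>. (\<integral>\<^sup>+s\<in>{0..}. indicator B (s, \<omega>) \<partial>jump_measure T \<omega>) \<partial>M) =
      (\<integral>\<^sup>+\<omega>. (\<Sum>n. at_event (indicator B) n \<omega>) \<partial>M)"
    by (intro nn_integral_cong) (simp add: nn_integral_jump_measure[OF f])
  finally have "AE \<omega> in M. (\<Sum>n. at_event (indicator B) n \<omega> :: ennreal) \<noteq> \<infinity>"
    using at_event_measurable[OF f] by (intro nn_integral_noteq_infinite) auto
  then show ?thesis
  proof (eventually_elim)
    case (elim \<omega>)
    define S where "S = {n. 1 \<le> n \<and> T n \<omega> < \<infinity> \<and> (enn2real (T n \<omega>), \<omega>) \<in> B}"
    have "at_event (indicator B) n \<omega> = (indicator S n :: ennreal)" for n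
      by (auto simp: at_event_def S_def indicator_def)
    then have "(\<Sum>n. indicator S n :: ennreal) \<noteq> \<infinity>" using elim by simp
    moreover have "(\<Sum>n. indicator S n :: ennreal) = emeasure (count_space UNIV) S"
      by (simp add: nn_integral_count_space_nat[symmetric])
    ultimately have "finite S" by (metis emeasure_count_space_infinite infinity_ennreal_def subset_UNIV)
    moreover have "{n \<in> arrivals i \<omega>. (enn2real (T n \<omega>), \<omega>) \<in> below k} \<subseteq> S"
    proof safe
      fix n assume n: "n \<in> arrivals i \<omega>" "(enn2real (T n \<omega>), \<omega>) \<in> below k"
      then have "T n \<omega> < \<infinity>" "enn2real (T n \<omega>) \<le> i"
        by (auto simp: arrivals_def le_less_trans[OF _ ennreal_less_top] enn2real_leI)
      then show "n \<in> S" using n by (auto simp: S_def B_def arrivals_def below_def space_Pred)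
    qed
    ultimately show ?case by (rule finite_subset[rotated])
  qed
qed

text \<open>Each path is bounded on \<open>{0..i}\<close>, so a single level \<open>k\<close>
  catches all its events up to \<open>i\<close>; countably many pairs \<open>i\<close>,
  \<open>k\<close> leave one null set. From here on \<open>counting_process\<close> really counts,
  instead of taking the default value of \<open>card\<close> on infinite sets.\<close>

lemma AE_finite_arrivals: "AE \<omega> in M. \<forall>t\<ge>0. finite (arrivals t \<omega>)"
proof -
  have "AE \<omega> in M. \<forall>(i::nat) (k::nat). finite {n \<in> arrivals i \<omega>. (enn2real (T n \<omega>), \<omega>) \<in> below k}"
    using AE_finite_arrivals_below by (intro AE_all_countable[THEN iffD2] allI)
  then show ?thesis
    using AE_space
  proof (eventually_elim, safe)
    fix \<omega> and t :: real assume \<omega>: "\<omega> \<in> space M" and "0 \<le> t"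
      and fin: "\<forall>(i::nat) (k::nat). finite {n \<in> arrivals i \<omega>. (enn2real (T n \<omega>), \<omega>) \<in> below k}"
    obtain i :: nat where i: "t \<le> i" using real_arch_simple by auto
    obtain k :: nat where k: "(real i, \<omega>) \<in> below k"
      using eventually_below[OF \<omega>, of i] by (auto simp: eventually_sequentially)
    have "arrivals t \<omega> \<subseteq> {n \<in> arrivals i \<omega>. (enn2real (T n \<omega>), \<omega>) \<in> below k}"
    proof safe
      fix n assume n: "n \<in> arrivals t \<omega>"
      then have "T n \<omega> \<le> ennreal (real i)"
        using i by (auto simp: arrivals_def elim!: order_trans intro!: ennreal_leI)
      then show "n \<in> arrivals i \<omega>" "(enn2real (T n \<omega>), \<omega>) \<in> below k"
        using n by (auto simp: arrivals_def enn2real_leI intro!: below_antimono[OF k])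
    qed
    then show "finite (arrivals t \<omega>)" using fin finite_subset by blast
  qed
qed

text \<open>At time 0 \<open>lam_left\<close> is the value \<open>lam 0\<close> rather than a limit
  from the left, so it would include the jump of an event there. Such events are ruled out because a
  single time has Lebesgue measure 0 in the intensity identity.\<close>

lemma AE_T_pos: "AE \<omega> in M. \<forall>n\<ge>1. 0 < T n \<omega>"
proof -
  have "{0} \<times> space M \<in> sets Pred"
    using sets.top[of "F 0"] by (intro Pred_zero) (simp add: space_F)
  then have f: "indicator ({0} \<times> space M) \<in> borel_measurable Pred" by simp
  have "(\<integral>\<^sup>+s\<in>{0..}. indicator ({0} \<times> space M) (s, \<omega>) * ennreal (lam s \<omega>) \<partial>lborel) = (\<integral>\<^sup>+s. 0 \<partial>(lborel :: real measure))" for \<omega>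
    by (rule nn_integral_cong_AE)
      (use AE_lborel_singleton[of "0::real"] in eventually_elim, auto)
  then have "0 = (\<integral>\<^sup>+\<omega>. (\<integral>\<^sup>+s\<in>{0..}. indicator ({0} \<times> space M) (s, \<omega>) \<partial>jump_measure T \<omega>) \<partial>M)"
    unfolding intensity_formula[OF f] by simp
  also have "\<dots> = (\<integral>\<^sup>+\<omega>. (\<Sum>n. at_event (indicator ({0} \<times> space M)) n \<omega>) \<partial>M)"
    by (intro nn_integral_cong) (simp add: nn_integral_jump_measure[OF f])
  finally have "AE \<omega> in M. (\<Sum>n. at_event (indicator ({0} \<times> space M)) n \<omega> :: ennreal) = 0"
    using at_event_measurable[OF f] by (subst nn_integral_0_iff_AE[symmetric]) auto
  then show ?thesis
    using AE_space
  proof (eventually_elim, safe)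
    fix \<omega> and n :: nat
    assume \<omega>: "\<omega> \<in> space M" and n: "1 \<le> n"
      and z: "(\<Sum>n. at_event (indicator ({0} \<times> space M)) n \<omega> :: ennreal) = 0"
    have "at_event (indicator ({0} \<times> space M)) n \<omega> \<le> (0::ennreal)"
      using z sum_le_suminf[OF summableI, of "{n}" "\<lambda>n. at_event (indicator ({0} \<times> space M)) n \<omega> :: ennreal"]
      by simp
    then show "0 < T n \<omega>"
      using \<omega> n by (cases "T n \<omega> = 0") (auto simp: at_event_def zero_less_iff_neq_zero)
  qed
qed

text \<open>The exceptional null sets are collected once, so that the statements about paths below
  are free of \<open>AE\<close>.\<close>

definition good :: "'a \<Rightarrow> bool" where
  "good \<omega> \<longleftrightarrow> \<omega> \<in> space M \<and> (\<forall>t\<ge>0. finite (arrivals t \<omega>)) \<and> (\<forall>n\<ge>1. 0 < T n \<omega>) \<and>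
    (\<forall>n\<ge>1. T n \<omega> < \<infinity> \<longrightarrow> T n \<omega> < T (Suc n) \<omega>) \<and>
    (\<forall>t\<ge>0. lam t \<omega> = lam 0 \<omega> + (LINT s:{0..t}|lborel. \<alpha> * (lam0 - lam s \<omega>)) + \<beta> * compound_process T Xs t \<omega>)"

lemma AE_good: "AE \<omega> in M. good \<omega>"
  using AE_space AE_finite_arrivals AE_T_pos simple dynamics
  unfolding good_def by eventually_elim blast

lemma
  assumes "good \<omega>"
  shows good_space: "\<omega> \<in> space M"
    and good_finite: "0 \<le> t \<Longrightarrow> finite (arrivals t \<omega>)"
    and good_pos: "1 \<le> n \<Longrightarrow> 0 < T n \<omega>"
    and good_less: "1 \<le> n \<Longrightarrow> T n \<omega> < \<infinity> \<Longrightarrow> T n \<omega> < T (Suc n) \<omega>"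
    and good_dynamics: "0 \<le> t \<Longrightarrow> lam t \<omega> =
      lam 0 \<omega> + (LINT s:{0..t}|lborel. \<alpha> * (lam0 - lam s \<omega>)) + \<beta> * compound_process T Xs t \<omega>"
  using assms unfolding good_def by blast+

lemma arrivals_finite_time: "n \<in> arrivals t \<omega> \<Longrightarrow> T n \<omega> < \<infinity>"
  unfolding arrivals_def by (auto intro: le_less_trans[OF _ ennreal_less_top])

lemma arrivals_iff:
  assumes "T n \<omega> < \<infinity>" "0 \<le> s"
  shows "n \<in> arrivals s \<omega> \<longleftrightarrow> 1 \<le> n \<and> enn2real (T n \<omega>) \<le> s"
  using assms by (cases "T n \<omega>") (auto simp: arrivals_def)

lemma arrivals_mono: "s \<le> t \<Longrightarrow> arrivals s \<omega> \<subseteq> arrivals t \<omega>"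
  by (auto simp: arrivals_def elim!: order_trans intro!: ennreal_leI)

lemma arrivals_eq:
  assumes "good \<omega>" "0 \<le> t"
  shows "arrivals t \<omega> = {1..counting_process T t \<omega>}"
proof -
  have "arrivals t \<omega> = {1..card (arrivals t \<omega>)}"
  proof (rule initial_segment_of_nat)
    show "finite (arrivals t \<omega>)" using assms by (simp add: good_finite)
    show "arrivals t \<omega> \<subseteq> {1..}" by (auto simp: arrivals_def)
    fix n assume "1 \<le> n" "Suc n \<in> arrivals t \<omega>"
    then show "n \<in> arrivals t \<omega>"
      using nondecreasing[of n \<omega>] good_space assms by (auto simp: arrivals_def)
  qed
  then show ?thesis by (simp add: counting_process_def arrivals_def)
qed

lemma T_less:
  assumes "good \<omega>" "1 \<le> m" "m < n" "T n \<omega> < \<infinity>"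
  shows "T m \<omega> < T n \<omega>"
  using assms(3,2,4)
proof (induction rule: strict_inc_induct)
  case (base i)
  have "T i \<omega> \<le> T (Suc i) \<omega>" using nondecreasing[OF _ good_space] assms(1) base by simp
  then have "T i \<omega> < \<infinity>" using base by auto
  then show ?case using good_less[OF assms(1)] base by simp
next
  case (step i)
  then have "T (Suc i) \<omega> < T n \<omega>" by simp
  moreover have "T i \<omega> \<le> T (Suc i) \<omega>" using nondecreasing[OF _ good_space] assms(1) step by simp
  ultimately show ?case by (rule le_less_trans[rotated])
qed

subsection \<open>The square of the intensity along a path\<close>

lemma arrivals_ge_1: "n \<in> arrivals t \<omega> \<Longrightarrow> 1 \<le> n"
  by (simp add: arrivals_def)

lemma arrivals_le: "n \<in> arrivals t \<omega> \<Longrightarrow> 0 \<le> t \<Longrightarrow> enn2real (T n \<omega>) \<le> t"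
  using arrivals_iff[OF arrivals_finite_time] by blast

lemma integrable_path:
  fixes h :: "real \<Rightarrow> real"
  assumes \<omega>: "\<omega> \<in> space M" and "0 \<le> t" and h: "continuous_on UNIV h"
  shows "integrable lborel (\<lambda>s. indicator {0..t} s * h (lam (max 0 s) \<omega>))"
proof -
  have [measurable]: "h \<in> borel_measurable borel" using h by (rule borel_measurable_continuous_onI)
  note [measurable] = lam_section[OF \<omega>]
  obtain K where K: "\<forall>s\<in>{0..t}. \<bar>lam s \<omega>\<bar> \<le> K"
    using cadlag_path_bounded[OF lam_cadlag[OF \<omega>] \<open>0 \<le> t\<close>] by blast
  have "compact (h ` {-K..K})"
    by (intro compact_continuous_image) (auto intro: continuous_on_subset[OF h])
  then have "bounded (h ` {-K..K})" by (rule compact_imp_bounded)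
  then obtain L where L: "\<forall>x\<in>{-K..K}. \<bar>h x\<bar> \<le> L"
    unfolding bounded_iff by auto
  show ?thesis
  proof (rule Bochner_Integration.integrable_bound)
    show "integrable lborel (\<lambda>s. indicator {0..t} s * L)"
      by (intro integrable_mult_left integrable_real_indicator) (auto simp: emeasure_lborel_Icc_eq)
    have "\<bar>h (lam s \<omega>)\<bar> \<le> \<bar>L\<bar>" if "s \<in> {0..t}" for s
    proof -
      have "lam s \<omega> \<in> {-K..K}" using bspec[OF K that] by auto
      then show ?thesis using L by fastforce
    qed
    then show "AE s in lborel. norm (indicator {0..t} s * h (lam (max 0 s) \<omega>)) \<le> norm (indicator {0..t} s * L)"
      by (auto simp: indicator_def max_def)
  qed measurable
qed

definition cont_part :: "'a \<Rightarrow> real \<Rightarrow> real" where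
  "cont_part \<omega> s = l + (LBINT u. indicator {0..s} u * (\<alpha> * (lam0 - lam (max 0 u) \<omega>)))"

lemma drift_integrable:
  assumes "\<omega> \<in> space M" "0 \<le> t"
  shows "integrable lborel (\<lambda>s. indicator {0..t} s * (\<alpha> * (lam0 - lam (max 0 s) \<omega>)))"
  using integrable_path[OF assms, of "\<lambda>x. \<alpha> * (lam0 - x)"] by (simp add: continuous_intros)

lemma cont_part_left_continuous:
  assumes \<omega>: "\<omega> \<in> space M" and s: "0 < s"
  shows "(cont_part \<omega> \<longlongrightarrow> cont_part \<omega> s) (at_left s)"
proof -
  let ?f = "\<lambda>u. \<alpha> * (lam0 - lam (max 0 u) \<omega>)"
  have i: "set_integrable lborel {0..u} ?f" if "0 \<le> u" for u
    using drift_integrable[OF \<omega> that] by (simp add: set_integrable_def)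
  have eq: "cont_part \<omega> u = l + integral {0..u} ?f" if "0 \<le> u" for u
    using set_borel_integral_eq_integral(2)[OF i[OF that]]
    unfolding cont_part_def set_lebesgue_integral_def real_scaleR_def by simp
  have "continuous_on {0..s} (\<lambda>u. integral {0..u} ?f)"
    using set_borel_integral_eq_integral(1)[OF i[of s]] s by (intro indefinite_integral_continuous_1) simp
  then have "((\<lambda>u. integral {0..u} ?f) \<longlongrightarrow> integral {0..s} ?f) (at s within {0..s})"
    using s by (auto simp: continuous_on_def)
  then have "((\<lambda>u. l + integral {0..u} ?f) \<longlongrightarrow> cont_part \<omega> s) (at s within {0..s})"
    using s by (subst eq) (auto intro!: tendsto_intros)
  moreover have "at s within {0..s} = at_left s"
    using s by (simp add: at_within_Icc_at_left)
  ultimately have "((\<lambda>u. l + integral {0..u} ?f) \<longlongrightarrow> cont_part \<omega> s) (at_left s)" by simp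
  then show ?thesis
  proof (rule Lim_transform_eventually)
    have "eventually (\<lambda>u. u \<in> {0<..<s}) (at_left s)" by (rule eventually_at_left_real[OF s])
    then show "eventually (\<lambda>u. l + integral {0..u} ?f = cont_part \<omega> u) (at_left s)"
      by eventually_elim (simp add: eq)
  qed
qed

lemma lam_decomposition:
  assumes \<omega>: "good \<omega>" and s: "0 \<le> s" "s \<le> t"
  shows "lam s \<omega> = cont_part \<omega> s + (\<Sum>n | n \<in> arrivals t \<omega> \<and> enn2real (T n \<omega>) \<le> s. \<beta> * Xs n \<omega>)"
proof -
  have "arrivals s \<omega> = {n. n \<in> arrivals t \<omega> \<and> enn2real (T n \<omega>) \<le> s}"
    using arrivals_mono[OF s(2), of \<omega>] arrivals_iff[OF arrivals_finite_time s(1)]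
      arrivals_le[OF _ s(1)] arrivals_ge_1 by blast
  then have "\<beta> * compound_process T Xs s \<omega> = (\<Sum>n | n \<in> arrivals t \<omega> \<and> enn2real (T n \<omega>) \<le> s. \<beta> * Xs n \<omega>)"
    unfolding compound_process_def arrivals_eq[OF \<omega> s(1), symmetric] by (simp add: sum_distrib_left)
  moreover have "(LINT u:{0..s}|lborel. \<alpha> * (lam0 - lam u \<omega>)) = (LBINT u. indicator {0..s} u * (\<alpha> * (lam0 - lam (max 0 u) \<omega>)))"
    unfolding set_lebesgue_integral_def by (intro Bochner_Integration.integral_cong) (auto simp: indicator_def)
  ultimately show ?thesis
    using good_dynamics[OF \<omega> s(1)] initial[OF good_space[OF \<omega>]] by (simp add: cont_part_def)
qed

lemma lam_left_decomposition:
  assumes \<omega>: "good \<omega>" and s: "0 < s" "s \<le> t"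
  shows "lam_left (s, \<omega>) = cont_part \<omega> s + (\<Sum>n | n \<in> arrivals t \<omega> \<and> enn2real (T n \<omega>) < s. \<beta> * Xs n \<omega>)"
proof (rule lam_left_eq[OF s(1)])
  let ?S = "\<Sum>n | n \<in> arrivals t \<omega> \<and> enn2real (T n \<omega>) < s. \<beta> * Xs n \<omega>"
  have "((\<lambda>u. cont_part \<omega> u + ?S) \<longlongrightarrow> cont_part \<omega> s + ?S) (at_left s)"
    by (intro tendsto_intros cont_part_left_continuous good_space \<omega> s)
  then show "((\<lambda>u. lam u \<omega>) \<longlongrightarrow> cont_part \<omega> s + ?S) (at_left s)"
  proof (rule Lim_transform_eventually)
    have "eventually (\<lambda>u. u \<in> {0<..<s}) (at_left s)" by (rule eventually_at_left_real[OF s(1)])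
    \<comment> \<open>There are finitely many events, so close to the left of \<open>s\<close> every
      event before \<open>s\<close> has already occurred and the jump sum is constant.\<close>
    moreover have "eventually (\<lambda>u. \<forall>n\<in>arrivals t \<omega>. enn2real (T n \<omega>) < s \<longrightarrow> enn2real (T n \<omega>) \<le> u) (at_left s)"
    proof (rule eventually_ball_finite)
      show "finite (arrivals t \<omega>)" using good_finite[OF \<omega>, of t] s by simp
      show "\<forall>n\<in>arrivals t \<omega>. eventually (\<lambda>u. enn2real (T n \<omega>) < s \<longrightarrow> enn2real (T n \<omega>) \<le> u) (at_left s)"
      proof
        fix n
        show "eventually (\<lambda>u. enn2real (T n \<omega>) < s \<longrightarrow> enn2real (T n \<omega>) \<le> u) (at_left s)"
        proof (cases "enn2real (T n \<omega>) < s")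
          case True
          from eventually_at_left_real[OF this] show ?thesis by eventually_elim auto
        qed simp
      qed
    qed
    ultimately show "eventually (\<lambda>u. cont_part \<omega> u + ?S = lam u \<omega>) (at_left s)"
    proof eventually_elim
      case (elim u)
      then have "{n. n \<in> arrivals t \<omega> \<and> enn2real (T n \<omega>) \<le> u} = {n. n \<in> arrivals t \<omega> \<and> enn2real (T n \<omega>) < s}"
        by force
      then show ?case using lam_decomposition[OF \<omega>, of u t] elim s by simp
    qed
  qed
qed

text \<open>The left limit and the value can differ only at event times, which are countable. This
  permits writing \<open>lam\<close> for the predictable \<open>lam_left\<close> in every integral
  over time.\<close>

lemma AE_lam_left:
  assumes \<omega>: "good \<omega>"
  shows "AE s in lborel. 0 < s \<longrightarrow> lam_left (s, \<omega>) = lam s \<omega>"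
proof -
  have "AE s in lborel. s \<notin> range (\<lambda>n. enn2real (T n \<omega>))"
    by (intro AE_not_in countable_imp_null_set_lborel) simp
  then show ?thesis
  proof (eventually_elim, safe)
    fix s :: real assume s: "s \<notin> range (\<lambda>n. enn2real (T n \<omega>))" "0 < s"
    have "{n. n \<in> arrivals s \<omega> \<and> enn2real (T n \<omega>) < s} = {n. n \<in> arrivals s \<omega> \<and> enn2real (T n \<omega>) \<le> s}"
      using s(1) by (intro Collect_cong) (metis less_le rangeI)
    then show "lam_left (s, \<omega>) = lam s \<omega>"
      using lam_decomposition[OF \<omega>, of s s] lam_left_decomposition[OF \<omega>, of s s] s by simp
  qed
qed

lemma linear_path:
  assumes \<omega>: "good \<omega>" and t: "0 \<le> t"
  shows "lam t \<omega> = l + (LBINT s. indicator {0..t} s * (\<alpha> * (lam0 - lam (max 0 s) \<omega>))) + (\<Sum>n\<in>arrivals t \<omega>. \<beta> * Xs n \<omega>)"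
proof -
  have "{n \<in> arrivals t \<omega>. enn2real (T n \<omega>) \<le> t} = arrivals t \<omega>"
    using arrivals_le[OF _ t] by blast
  then show ?thesis
    using lam_decomposition[OF \<omega> t order_refl] by (simp add: cont_part_def)
qed

lemma square_path:
  assumes \<omega>: "good \<omega>" and t: "0 \<le> t"
  shows "(lam t \<omega>)\<^sup>2 = l\<^sup>2 + (LBINT s. indicator {0..t} s * (2 * \<alpha> * (lam0 * lam (max 0 s) \<omega> - (lam (max 0 s) \<omega>)\<^sup>2)))
    + (\<Sum>n\<in>arrivals t \<omega>. 2 * \<beta> * lam_left (enn2real (T n \<omega>), \<omega>) * Xs n \<omega> + \<beta>\<^sup>2 * (Xs n \<omega>)\<^sup>2)"
proof -
  define N where "N = counting_process T t \<omega>"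
  have N: "arrivals t \<omega> = {1..N}" unfolding N_def by (rule arrivals_eq[OF \<omega> t])
  define f where "f s = indicator {0..t} s * (\<alpha> * (lam0 - lam (max 0 s) \<omega>))" for s
  define \<tau> where "\<tau> n = enn2real (T n \<omega>)" for n
  define c where "c n = \<beta> * Xs n \<omega>" for n
  have f: "integrable lborel f"
    unfolding f_def by (rule drift_integrable[OF good_space[OF \<omega>] t])
  have fin: "T n \<omega> < \<infinity>" if "n \<in> {1..N}" for n using that arrivals_finite_time[of n t \<omega>] N by simp
  have \<tau>: "0 < \<tau> n" "\<tau> n \<le> t" if "n \<in> {1..N}" for n
  proof -
    have "n \<in> arrivals t \<omega>" using that N by simp
    then show "\<tau> n \<le> t" using fin[OF that] t by (simp add: \<tau>_def arrivals_iff)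
    show "0 < \<tau> n" using good_pos[OF \<omega>, of n] that fin[OF that] by (simp add: \<tau>_def enn2real_positive_iff)
  qed
  have cp: "cont_part \<omega> s = l + (LBINT u. indicator {..s} u * f u)" if "s \<le> t" for s
    unfolding cont_part_def f_def using that
    by (auto intro!: Bochner_Integration.integral_cong simp: indicator_def)
  have y: "l + (LBINT u. indicator {..s} u * f u) + (\<Sum>j | j \<in> {1..N} \<and> \<tau> j \<le> s. c j) = lam s \<omega>"
    if "0 \<le> s" "s \<le> t" for s
    using lam_decomposition[OF \<omega> that] cp[OF that(2)] by (simp add: N c_def \<tau>_def)
  \<comment> \<open>The step that needs strictly increasing event times.
    \<open>square_of_jump_path\<close> pairs jump \<open>n\<close> with all jumps of smaller index;
    these make up the left limit at \<open>\<tau> n\<close> only if none of them happens at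
    \<open>\<tau> n\<close> itself.\<close>
  have ll: "l + (LBINT u. indicator {..\<tau> n} u * f u) + (\<Sum>j = 1..<n. c j) = lam_left (\<tau> n, \<omega>)"
    if n: "n \<in> {1..N}" for n
  proof -
    have "{j. j \<in> arrivals t \<omega> \<and> enn2real (T j \<omega>) < \<tau> n} = {1..<n}"
    proof -
      have "\<tau> j < \<tau> n" if "1 \<le> j" "j < n" for j
        using T_less[OF \<omega> that fin[OF n]] fin[OF n] by (simp add: \<tau>_def enn2real_less_iff enn2real_mono less_top)
      moreover have "\<tau> n \<le> \<tau> j" if "j \<in> {1..N}" "n \<le> j" for j
      proof (cases "n = j")
        case False
        then have "T n \<omega> < T j \<omega>" using T_less[OF \<omega> _ _ fin[OF that(1)]] n that by simp
        then show ?thesis using fin[OF that(1)] unfolding \<tau>_def by (intro enn2real_mono) auto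
      qed simp
      ultimately show ?thesis
        unfolding N \<tau>_def[symmetric] using n by (auto simp: not_le[symmetric])
    qed
    then show ?thesis
      using lam_left_decomposition[OF \<omega> \<tau>[OF n]] cp[OF \<tau>(2)[OF n]] by (simp add: c_def)
  qed
  have "(lam t \<omega>)\<^sup>2 = l\<^sup>2 + (LBINT s. 2 * (l + (LBINT u. indicator {..s} u * f u) + (\<Sum>j | j \<in> {1..N} \<and> \<tau> j \<le> s. c j)) * f s)
      + (\<Sum>n = 1..N. 2 * (l + (LBINT u. indicator {..\<tau> n} u * f u) + (\<Sum>j = 1..<n. c j)) * c n + (c n)\<^sup>2)"
    using square_of_jump_path[where f = f and c = c and \<tau> = \<tau> and l = l and t = t and N = N] f \<tau>
    by (simp add: f_def[of "_"] y[OF t order_refl, symmetric])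
  also have "(LBINT s. 2 * (l + (LBINT u. indicator {..s} u * f u) + (\<Sum>j | j \<in> {1..N} \<and> \<tau> j \<le> s. c j)) * f s) =
      (LBINT s. indicator {0..t} s * (2 * \<alpha> * (lam0 * lam (max 0 s) \<omega> - (lam (max 0 s) \<omega>)\<^sup>2)))"
  proof (rule Bochner_Integration.integral_cong[OF refl])
    fix s
    show "2 * (l + (LBINT u. indicator {..s} u * f u) + (\<Sum>j | j \<in> {1..N} \<and> \<tau> j \<le> s. c j)) * f s =
      indicator {0..t} s * (2 * \<alpha> * (lam0 * lam (max 0 s) \<omega> - (lam (max 0 s) \<omega>)\<^sup>2))"
    proof (cases "0 \<le> s \<and> s \<le> t")
      case True
      then show ?thesis
        unfolding y[OF True[THEN conjunct1] True[THEN conjunct2]]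
        by (simp add: f_def max_def power2_eq_square algebra_simps)
    qed (auto simp: f_def)
  qed
  also have "(\<Sum>n = 1..N. 2 * (l + (LBINT u. indicator {..\<tau> n} u * f u) + (\<Sum>j = 1..<n. c j)) * c n + (c n)\<^sup>2) =
      (\<Sum>n\<in>arrivals t \<omega>. 2 * \<beta> * lam_left (enn2real (T n \<omega>), \<omega>) * Xs n \<omega> + \<beta>\<^sup>2 * (Xs n \<omega>)\<^sup>2)"
    unfolding N
  proof (rule sum.cong[OF refl])
    fix n assume n: "n \<in> {1..N}"
    show "2 * (l + (LBINT u. indicator {..\<tau> n} u * f u) + (\<Sum>j = 1..<n. c j)) * c n + (c n)\<^sup>2 =
        2 * \<beta> * lam_left (enn2real (T n \<omega>), \<omega>) * Xs n \<omega> + \<beta>\<^sup>2 * (Xs n \<omega>)\<^sup>2"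
      unfolding ll[OF n] by (simp add: c_def \<tau>_def power_mult_distrib)
  qed
  finally show ?thesis .
qed

text \<open>For \<open>Y = indicator (below k)\<close> this is the square of the intensity stopped at its first passage above \<open>k\<close>.\<close>

definition stopped_square :: "(real \<times> 'a \<Rightarrow> real) \<Rightarrow> real \<Rightarrow> 'a \<Rightarrow> real" where
  "stopped_square Y t \<omega> = l\<^sup>2
    + (LBINT s. indicator {0..t} s * (Y (s, \<omega>) * (2 * \<alpha> * (lam0 * lam (max 0 s) \<omega> - (lam (max 0 s) \<omega>)\<^sup>2))))
    + (\<Sum>n\<in>arrivals t \<omega>. Y (enn2real (T n \<omega>), \<omega>) *
        (2 * \<beta> * lam_left (enn2real (T n \<omega>), \<omega>) * Xs n \<omega> + \<beta>\<^sup>2 * (Xs n \<omega>)\<^sup>2))"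

text \<open>The witness \<open>\<sigma>\<close> is the supremum of the times up to \<open>t\<close>
  in \<open>below k\<close>. It belongs to \<open>below k\<close> itself, because membership
  constrains strictly earlier times only. Hence the weight cuts the path after
  \<open>\<sigma>\<close>, keeping a jump at \<open>\<sigma>\<close>, and \<open>square_path\<close>
  at \<open>\<sigma>\<close> gives the value \<open>lam \<sigma> \<omega>\<close> rather than the
  left limit.\<close>

lemma stopped_square_below:
  assumes \<omega>: "good \<omega>" and t: "0 \<le> t"
  shows "\<exists>\<sigma>. 0 \<le> \<sigma> \<and> stopped_square (indicator (below k)) t \<omega> = (lam \<sigma> \<omega>)\<^sup>2 \<and> ((t, \<omega>) \<in> below k \<longrightarrow> \<sigma> = t)"
proof -
  define D where "D = {s. 0 \<le> s \<and> s \<le> t \<and> (s, \<omega>) \<in> below k}"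
  define \<sigma> where "\<sigma> = Sup D"
  have "0 \<in> D" using good_space[OF \<omega>] t by (auto simp: D_def below_def)
  have bdd: "bdd_above D" by (intro bdd_aboveI[of _ t]) (auto simp: D_def)
  have "0 \<le> \<sigma>" unfolding \<sigma>_def by (rule cSup_upper[OF \<open>0 \<in> D\<close> bdd])
  have "\<sigma> \<le> t" unfolding \<sigma>_def using \<open>0 \<in> D\<close> by (intro cSup_least) (auto simp: D_def)
  have "lam q \<omega> \<le> k" if q: "q \<in> \<rat>" "0 \<le> q" "q < \<sigma>" for q
  proof -
    obtain s where "s \<in> D" "q < s"
      using less_cSupD[of D q] q(3) \<open>0 \<in> D\<close> unfolding \<sigma>_def by blast
    then show ?thesis using q by (auto simp: D_def below_def)
  qed
  then have \<sigma>: "(\<sigma>, \<omega>) \<in> below k"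
    using \<open>0 \<le> \<sigma>\<close> good_space[OF \<omega>] by (auto simp: below_def)
  have iff: "(s, \<omega>) \<in> below k \<longleftrightarrow> s \<le> \<sigma>" if "0 \<le> s" "s \<le> t" for s
  proof
    assume "(s, \<omega>) \<in> below k"
    then show "s \<le> \<sigma>" unfolding \<sigma>_def using that by (intro cSup_upper[OF _ bdd]) (auto simp: D_def)
  qed (rule below_antimono[OF \<sigma> that(1)])
  have a: "{n \<in> arrivals t \<omega>. (enn2real (T n \<omega>), \<omega>) \<in> below k} = arrivals \<sigma> \<omega>"
  proof -
    have "(enn2real (T n \<omega>), \<omega>) \<in> below k \<longleftrightarrow> n \<in> arrivals \<sigma> \<omega>" if n: "n \<in> arrivals t \<omega>" for n
    proof -
      note fin = arrivals_finite_time[OF n]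
      have "enn2real (T n \<omega>) \<le> t" "1 \<le> n" using n arrivals_iff[OF fin t] by auto
      then show ?thesis
        using arrivals_iff[OF fin \<open>0 \<le> \<sigma>\<close>] iff[of "enn2real (T n \<omega>)"] by auto
    qed
    then show ?thesis using arrivals_mono[OF \<open>\<sigma> \<le> t\<close>, of \<omega>] by auto
  qed
  have "stopped_square (indicator (below k)) t \<omega> = (lam \<sigma> \<omega>)\<^sup>2"
    unfolding square_path[OF \<omega> \<open>0 \<le> \<sigma>\<close>] stopped_square_def
  proof (intro arg_cong2[where f = "(+)"] refl)
    show "(LBINT s. indicator {0..t} s * (indicator (below k) (s, \<omega>) * (2 * \<alpha> * (lam0 * lam (max 0 s) \<omega> - (lam (max 0 s) \<omega>)\<^sup>2)))) =
        (LBINT s. indicator {0..\<sigma>} s * (2 * \<alpha> * (lam0 * lam (max 0 s) \<omega> - (lam (max 0 s) \<omega>)\<^sup>2)))"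
      using iff \<open>\<sigma> \<le> t\<close> by (intro Bochner_Integration.integral_cong) (auto simp: indicator_def)
    have mult_ind: "indicator B x * (y::real) = (if x \<in> B then y else 0)" for B and x :: "real \<times> 'a" and y
      by simp
    show "(\<Sum>n\<in>arrivals t \<omega>. indicator (below k) (enn2real (T n \<omega>), \<omega>) *
        (2 * \<beta> * lam_left (enn2real (T n \<omega>), \<omega>) * Xs n \<omega> + \<beta>\<^sup>2 * (Xs n \<omega>)\<^sup>2)) =
        (\<Sum>n\<in>arrivals \<sigma> \<omega>. 2 * \<beta> * lam_left (enn2real (T n \<omega>), \<omega>) * Xs n \<omega> + \<beta>\<^sup>2 * (Xs n \<omega>)\<^sup>2)"
      unfolding mult_ind a[symmetric] by (rule sum.inter_filter[OF good_finite[OF \<omega> t], symmetric])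
  qed
  moreover have "\<sigma> = t" if "(t, \<omega>) \<in> below k"
    using iff[OF t order_refl] that \<open>\<sigma> \<le> t\<close> by simp
  ultimately show ?thesis using \<open>0 \<le> \<sigma>\<close> by blast
qed

lemma stopped_square_one:
  "good \<omega> \<Longrightarrow> 0 \<le> t \<Longrightarrow> stopped_square (\<lambda>_. 1) t \<omega> = (lam t \<omega>)\<^sup>2"
  unfolding stopped_square_def using square_path[of \<omega> t] by simp

subsection \<open>Expectations of compound sums\<close>

sublocale time: pair_sigma_finite lborel M ..

abbreviation lamR :: "real \<times> 'a \<Rightarrow> real" where
  "lamR w \<equiv> lam (max 0 (fst w)) (snd w)"

lemma lamR_measurable [measurable]: "lamR \<in> borel_measurable (lborel \<Otimes>\<^sub>M M)"
  using lam_joint by (simp cong: measurable_cong_sets sets_pair_measure_cong)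

text \<open>The function \<open>H\<close> represents \<open>f\<close> times the intensity for almost
  all times only. This freedom lets it be bounded everywhere, or contain \<open>lam\<close> where
  \<open>f\<close> contains \<open>lam_left\<close>. The sum over the random index set is handled
  through a measurable version \<open>S\<close>, which avoids proving measurability off the good
  paths.\<close>

lemma campbell_nonneg:
  fixes f :: "real \<times> 'a \<Rightarrow> real" and g :: "real \<Rightarrow> real"
  assumes t: "0 \<le> t" and f [measurable]: "f \<in> borel_measurable Pred"
    and f0: "\<And>s \<omega>. 0 \<le> s \<Longrightarrow> \<omega> \<in> space M \<Longrightarrow> 0 \<le> f (s, \<omega>)"
    and g [measurable]: "g \<in> borel_measurable borel" and g0: "\<And>x. 0 \<le> g x"
    and gX: "integrable M (\<lambda>\<omega>. g (X \<omega>))"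
    and H: "integrable (lborel \<Otimes>\<^sub>M M) H" and H0: "\<And>w. 0 \<le> H w"
    and H_eq: "AE \<omega> in M. AE s in lborel. H (s, \<omega>) = indicator {0..t} s * (f (s, \<omega>) * lam (max 0 s) \<omega>)"
  shows "\<exists>S. integrable M S \<and> expectation S = expectation (\<lambda>\<omega>. g (X \<omega>)) * integral\<^sup>L (lborel \<Otimes>\<^sub>M M) H \<and>
    (AE \<omega> in M. S \<omega> = (\<Sum>n\<in>arrivals t \<omega>. f (enn2real (T n \<omega>), \<omega>) * g (Xs n \<omega>)))"
proof -
  define F where "F w = ennreal (indicator {0..t} (fst w) * f w)" for w
  have F: "F \<in> borel_measurable Pred" unfolding F_def by measurable
  define R where "R \<omega> = (\<Sum>n. at_event F n \<omega> * ennreal (g (Xs n \<omega>)))" for \<omega>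
  have [measurable]: "R \<in> borel_measurable M"
  proof -
    note [measurable] = at_event_measurable[OF F]
    have "(\<lambda>\<omega>. at_event F n \<omega> * ennreal (g (Xs n \<omega>))) \<in> borel_measurable M" for n
      by (cases "1 \<le> n") (auto simp: at_event_def[of F 0] not_le)
    then show ?thesis unfolding R_def by measurable
  qed
  have RS: "R \<omega> = ennreal (\<Sum>n\<in>arrivals t \<omega>. f (enn2real (T n \<omega>), \<omega>) * g (Xs n \<omega>))" if \<omega>: "good \<omega>" for \<omega>
  proof -
    have "R \<omega> = (\<Sum>n\<in>arrivals t \<omega>. at_event F n \<omega> * ennreal (g (Xs n \<omega>)))"
      unfolding R_def
    proof (rule suminf_finite[OF good_finite[OF \<omega> t]])
      fix n assume n: "n \<notin> arrivals t \<omega>"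
      show "at_event F n \<omega> * ennreal (g (Xs n \<omega>)) = 0"
      proof (cases "1 \<le> n \<and> T n \<omega> < \<infinity>")
        case True
        then have "t < enn2real (T n \<omega>)" using n arrivals_iff[of n \<omega> t] t by auto
        then show ?thesis by (simp add: at_event_def F_def)
      qed (auto simp: at_event_def)
    qed
    also have "\<dots> = (\<Sum>n\<in>arrivals t \<omega>. ennreal (f (enn2real (T n \<omega>), \<omega>) * g (Xs n \<omega>)))"
    proof (rule sum.cong[OF refl])
      fix n assume n: "n \<in> arrivals t \<omega>"
      show "at_event F n \<omega> * ennreal (g (Xs n \<omega>)) = ennreal (f (enn2real (T n \<omega>), \<omega>) * g (Xs n \<omega>))"
        using arrivals_finite_time[OF n] arrivals_le[OF n t] arrivals_ge_1[OF n] f0[OF _ good_space[OF \<omega>]]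
        by (simp add: at_event_def F_def ennreal_mult g0)
    qed
    also have "\<dots> = ennreal (\<Sum>n\<in>arrivals t \<omega>. f (enn2real (T n \<omega>), \<omega>) * g (Xs n \<omega>))"
      by (intro sum_ennreal mult_nonneg_nonneg f0 g0 good_space \<omega>) simp
    finally show ?thesis .
  qed
  have "(\<integral>\<^sup>+\<omega>. R \<omega> \<partial>M) = (\<integral>\<^sup>+\<omega>. (\<integral>\<^sup>+s\<in>{0..}. F (s, \<omega>) * ennreal (lam s \<omega>) \<partial>lborel) \<partial>M) * (\<integral>\<^sup>+\<omega>. ennreal (g (X \<omega>)) \<partial>M)"
    unfolding R_def by (rule campbell_formula[OF F]) measurable
  also have "(\<integral>\<^sup>+\<omega>. (\<integral>\<^sup>+s\<in>{0..}. F (s, \<omega>) * ennreal (lam s \<omega>) \<partial>lborel) \<partial>M) =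
      (\<integral>\<^sup>+\<omega>. (\<integral>\<^sup>+s. ennreal (H (s, \<omega>)) \<partial>lborel) \<partial>M)"
  proof (rule nn_integral_cong_AE)
    show "AE \<omega> in M. (\<integral>\<^sup>+s\<in>{0..}. F (s, \<omega>) * ennreal (lam s \<omega>) \<partial>lborel) = (\<integral>\<^sup>+s. ennreal (H (s, \<omega>)) \<partial>lborel)"
      using H_eq AE_space
    proof eventually_elim
      case (elim \<omega>)
      show ?case
      proof (rule nn_integral_cong_AE)
        show "AE s in lborel. F (s, \<omega>) * ennreal (lam s \<omega>) * indicator {0..} s = ennreal (H (s, \<omega>))"
          using elim(1)
        proof eventually_elim
          case (elim s)
          then show ?case
            using f0[OF _ \<open>\<omega> \<in> space M\<close>, of s]
            by (auto simp: F_def indicator_def ennreal_mult lam_nonneg[OF \<open>\<omega> \<in> space M\<close>])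
        qed
      qed
    qed
  qed
  also have "\<dots> = (\<integral>\<^sup>+w. ennreal (H w) \<partial>(lborel \<Otimes>\<^sub>M M))"
    using borel_measurable_integrable[OF H] by (intro time.nn_integral_snd) auto
  also have "\<dots> = ennreal (integral\<^sup>L (lborel \<Otimes>\<^sub>M M) H)"
    by (rule nn_integral_eq_integral[OF H]) (simp add: H0)
  also have "(\<integral>\<^sup>+\<omega>. ennreal (g (X \<omega>)) \<partial>M) = ennreal (expectation (\<lambda>\<omega>. g (X \<omega>)))"
    by (rule nn_integral_eq_integral[OF gX]) (simp add: g0)
  finally have R: "(\<integral>\<^sup>+\<omega>. R \<omega> \<partial>M) = ennreal (expectation (\<lambda>\<omega>. g (X \<omega>)) * integral\<^sup>L (lborel \<Otimes>\<^sub>M M) H)"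
    by (simp add: ennreal_mult g0 H0 mult.commute)
  have nn: "(\<integral>\<^sup>+\<omega>. ennreal (enn2real (R \<omega>)) \<partial>M) = ennreal (expectation (\<lambda>\<omega>. g (X \<omega>)) * integral\<^sup>L (lborel \<Otimes>\<^sub>M M) H)"
    unfolding R[symmetric]
    by (rule nn_integral_cong_AE) (use AE_good in eventually_elim, simp add: RS)
  show ?thesis
  proof (intro exI[of _ "\<lambda>\<omega>. enn2real (R \<omega>)"] conjI)
    show "integrable M (\<lambda>\<omega>. enn2real (R \<omega>))"
      by (rule integrableI_nn_integral_finite[OF _ _ nn]) auto
    show "expectation (\<lambda>\<omega>. enn2real (R \<omega>)) = expectation (\<lambda>\<omega>. g (X \<omega>)) * integral\<^sup>L (lborel \<Otimes>\<^sub>M M) H"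
      by (subst integral_eq_nn_integral) (auto simp: nn g0 H0)
    show "AE \<omega> in M. enn2real (R \<omega>) = (\<Sum>n\<in>arrivals t \<omega>. f (enn2real (T n \<omega>), \<omega>) * g (Xs n \<omega>))"
      using AE_good
    proof eventually_elim
      case (elim \<omega>)
      have "0 \<le> (\<Sum>n\<in>arrivals t \<omega>. f (enn2real (T n \<omega>), \<omega>) * g (Xs n \<omega>))"
        by (intro sum_nonneg mult_nonneg_nonneg f0 g0 good_space elim) simp
      then show ?case by (simp add: RS[OF elim])
    qed
  qed
qed

text \<open>Only the marks are signed, so splitting \<open>g\<close> into positive and negative
  parts is enough; \<open>f\<close> is later a weight, possibly times the non-negative left
  limit.\<close>

lemma campbell_integrable:
  fixes f :: "real \<times> 'a \<Rightarrow> real" and g :: "real \<Rightarrow> real"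
  assumes t: "0 \<le> t" and f: "f \<in> borel_measurable Pred"
    and f0: "\<And>s \<omega>. 0 \<le> s \<Longrightarrow> \<omega> \<in> space M \<Longrightarrow> 0 \<le> f (s, \<omega>)"
    and g [measurable]: "g \<in> borel_measurable borel"
    and gX: "integrable M (\<lambda>\<omega>. g (X \<omega>))"
    and H: "integrable (lborel \<Otimes>\<^sub>M M) H" "\<And>w. 0 \<le> H w"
      "AE \<omega> in M. AE s in lborel. H (s, \<omega>) = indicator {0..t} s * (f (s, \<omega>) * lam (max 0 s) \<omega>)"
  obtains S where "integrable M S"
    "expectation S = expectation (\<lambda>\<omega>. g (X \<omega>)) * integral\<^sup>L (lborel \<Otimes>\<^sub>M M) H"
    "AE \<omega> in M. S \<omega> = (\<Sum>n\<in>arrivals t \<omega>. f (enn2real (T n \<omega>), \<omega>) * g (Xs n \<omega>))"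
proof -
  have i: "integrable M (\<lambda>\<omega>. max 0 (g (X \<omega>)))" "integrable M (\<lambda>\<omega>. max 0 (- g (X \<omega>)))"
    using gX by auto
  obtain S1 where S1: "integrable M S1"
    "expectation S1 = expectation (\<lambda>\<omega>. max 0 (g (X \<omega>))) * integral\<^sup>L (lborel \<Otimes>\<^sub>M M) H"
    "AE \<omega> in M. S1 \<omega> = (\<Sum>n\<in>arrivals t \<omega>. f (enn2real (T n \<omega>), \<omega>) * max 0 (g (Xs n \<omega>)))"
    using campbell_nonneg[OF t f f0 _ _ i(1) H] by auto
  obtain S2 where S2: "integrable M S2"
    "expectation S2 = expectation (\<lambda>\<omega>. max 0 (- g (X \<omega>))) * integral\<^sup>L (lborel \<Otimes>\<^sub>M M) H"
    "AE \<omega> in M. S2 \<omega> = (\<Sum>n\<in>arrivals t \<omega>. f (enn2real (T n \<omega>), \<omega>) * max 0 (- g (Xs n \<omega>)))"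
    using campbell_nonneg[OF t f f0 _ _ i(2) H] by auto
  have g_eq: "g x = max 0 (g x) - max 0 (- g x)" for x by simp
  show ?thesis
  proof
    show "integrable M (\<lambda>\<omega>. S1 \<omega> - S2 \<omega>)" using S1 S2 by simp
    have "expectation (\<lambda>\<omega>. g (X \<omega>)) = expectation (\<lambda>\<omega>. max 0 (g (X \<omega>)) - max 0 (- g (X \<omega>)))"
      using g_eq by simp
    also have "\<dots> = expectation (\<lambda>\<omega>. max 0 (g (X \<omega>))) - expectation (\<lambda>\<omega>. max 0 (- g (X \<omega>)))"
      using i by (rule Bochner_Integration.integral_diff)
    finally show "expectation (\<lambda>\<omega>. S1 \<omega> - S2 \<omega>) = expectation (\<lambda>\<omega>. g (X \<omega>)) * integral\<^sup>L (lborel \<Otimes>\<^sub>M M) H"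
      using S1 S2 by (simp add: left_diff_distrib)
    show "AE \<omega> in M. S1 \<omega> - S2 \<omega> = (\<Sum>n\<in>arrivals t \<omega>. f (enn2real (T n \<omega>), \<omega>) * g (Xs n \<omega>))"
      using S1(3) S2(3)
    proof eventually_elim
      case (elim \<omega>)
      show ?case
        unfolding elim sum_subtractf[symmetric] right_diff_distrib[symmetric] g_eq[symmetric] ..
    qed
  qed
qed

lemma X_integrable: "integrable M X"
  using square_integrable_imp_integrable[OF X_rv X_square] .

lemma lam_left_nonneg:
  assumes "0 \<le> s" "\<omega> \<in> space M"
  shows "0 \<le> lam_left (s, \<omega>)"
proof (cases "s = 0")
  case True
  have "(\<lambda>j. lam (max 0 ((of_int \<lceil>s * real (Suc j)\<rceil> - 1) / real (Suc j))) \<omega>) = (\<lambda>j. lam 0 \<omega>)"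
    using True by (simp add: max_def)
  then show ?thesis
    using lam_nonneg[OF assms(2), of 0] by (simp add: lam_left_def)
next
  case False
  then have "0 < s" using assms by simp
  obtain y where y: "((\<lambda>u. lam u \<omega>) \<longlongrightarrow> y) (at_left s)"
    using lam_cadlag[OF assms(2)] \<open>0 < s\<close> by (auto simp: cadlag_path_def)
  have "eventually (\<lambda>u. u \<in> {0<..<s}) (at_left s)" by (rule eventually_at_left_real[OF \<open>0 < s\<close>])
  then have "eventually (\<lambda>u. 0 \<le> lam u \<omega>) (at_left s)"
    by eventually_elim (simp add: lam_nonneg[OF assms(2)])
  then have "0 \<le> y" by (intro tendsto_lowerbound[OF y]) auto
  then show ?thesis by (simp add: lam_left_eq[OF \<open>0 < s\<close> y])
qed

text \<open>Origin of the constants: in \<open>A\<close> the term \<open>2 * \<alpha> * lam0\<close>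
  is the linear part of the drift and \<open>\<beta>\<^sup>2 * expectation (\<lambda>\<omega>. (X
  \<omega>)\<^sup>2)\<close> comes from the squared jumps; in \<open>2 * \<rho>\<close> the
  quadratic part of the drift gives \<open>- 2 * \<alpha>\<close> and the cross terms of the jumps
  give \<open>2 * \<beta> * expectation X\<close>.\<close>

lemma expectation_stopped_square:
  fixes Y :: "real \<times> 'a \<Rightarrow> real"
  assumes t: "0 \<le> t" and Y [measurable]: "Y \<in> borel_measurable Pred" and Y0: "\<And>w. 0 \<le> Y w"
    and H1: "integrable (lborel \<Otimes>\<^sub>M M) H1" "\<And>w. 0 \<le> H1 w"
      "AE \<omega> in M. AE s in lborel. H1 (s, \<omega>) = indicator {0..t} s * (Y (s, \<omega>) * lam (max 0 s) \<omega>)"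
    and H2: "integrable (lborel \<Otimes>\<^sub>M M) H2" "\<And>w. 0 \<le> H2 w"
      "AE \<omega> in M. AE s in lborel. H2 (s, \<omega>) = indicator {0..t} s * (Y (s, \<omega>) * (lam (max 0 s) \<omega>)\<^sup>2)"
  obtains Z where "integrable M Z"
    "expectation Z = l\<^sup>2 + (2 * \<alpha> * lam0 + \<beta>\<^sup>2 * expectation (\<lambda>\<omega>. (X \<omega>)\<^sup>2)) * integral\<^sup>L (lborel \<Otimes>\<^sub>M M) H1
       + 2 * (\<beta> * expectation X - \<alpha>) * integral\<^sup>L (lborel \<Otimes>\<^sub>M M) H2"
    "AE \<omega> in M. Z \<omega> = stopped_square Y t \<omega>"
proof -
  \<comment> \<open>The cross term brings the left limit, the intensity identity brings the value;
    for almost all times the product is a square.\<close>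
  have H2': "AE \<omega> in M. AE s in lborel. H2 (s, \<omega>) = indicator {0..t} s * (Y (s, \<omega>) * lam_left (s, \<omega>) * lam (max 0 s) \<omega>)"
    using H2(3) AE_good
  proof eventually_elim
    case (elim \<omega>)
    from elim(1) AE_lam_left[OF elim(2)] AE_lborel_singleton[of 0]
    show ?case
      by eventually_elim (auto simp: indicator_def max_def power2_eq_square)
  qed
  obtain S1 where S1: "integrable M S1"
    "expectation S1 = expectation X * integral\<^sup>L (lborel \<Otimes>\<^sub>M M) H2"
    "AE \<omega> in M. S1 \<omega> = (\<Sum>n\<in>arrivals t \<omega>. (Y (enn2real (T n \<omega>), \<omega>) * lam_left (enn2real (T n \<omega>), \<omega>)) * Xs n \<omega>)"
    by (rule campbell_integrable[OF t, of "\<lambda>w. Y w * lam_left w" "\<lambda>x. x" H2])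
      (use H2 H2' X_integrable Y0 lam_left_nonneg in auto)
  obtain S2 where S2: "integrable M S2"
    "expectation S2 = expectation (\<lambda>\<omega>. (X \<omega>)\<^sup>2) * integral\<^sup>L (lborel \<Otimes>\<^sub>M M) H1"
    "AE \<omega> in M. S2 \<omega> = (\<Sum>n\<in>arrivals t \<omega>. Y (enn2real (T n \<omega>), \<omega>) * (Xs n \<omega>)\<^sup>2)"
    by (rule campbell_integrable[OF t, of Y "\<lambda>x. x\<^sup>2" H1])
      (use H1 X_square Y0 in auto)
  define D where "D w = 2 * \<alpha> * (lam0 * H1 w - H2 w)" for w
  have D: "integrable (lborel \<Otimes>\<^sub>M M) D" unfolding D_def using H1 H2 by simp
  have D_int: "integrable M (\<lambda>\<omega>. LBINT s. D (s, \<omega>))"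
    "expectation (\<lambda>\<omega>. LBINT s. D (s, \<omega>)) = integral\<^sup>L (lborel \<Otimes>\<^sub>M M) D"
    using time.integrable_snd[of "\<lambda>s \<omega>. D (s, \<omega>)"] time.integral_snd[of "\<lambda>s \<omega>. D (s, \<omega>)"] D by simp_all
  have D_val: "integral\<^sup>L (lborel \<Otimes>\<^sub>M M) D = 2 * \<alpha> * (lam0 * integral\<^sup>L (lborel \<Otimes>\<^sub>M M) H1 - integral\<^sup>L (lborel \<Otimes>\<^sub>M M) H2)"
    unfolding D_def using H1 H2 by simp
  have D_eq: "AE \<omega> in M. (LBINT s. D (s, \<omega>)) =
      (LBINT s. indicator {0..t} s * (Y (s, \<omega>) * (2 * \<alpha> * (lam0 * lam (max 0 s) \<omega> - (lam (max 0 s) \<omega>)\<^sup>2))))"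
    using H1(3) H2(3) AE_space
  proof eventually_elim
    case (elim \<omega>)
    note \<omega> = \<open>\<omega> \<in> space M\<close>
    note [measurable] = lam_section[OF \<omega>]
    \<comment> \<open>Measurability of sections is available for \<open>ennreal\<close>-valued
      functions; the detour loses nothing, because \<open>Y\<close> is non-negative.\<close>
    have "(\<lambda>w. ennreal (Y w)) \<in> borel_measurable Pred" by measurable
    from borel_measurable_Pred_section[OF this \<omega>]
    have "(\<lambda>s. enn2real (ennreal (Y (s, \<omega>)) * indicator {0..} s)) \<in> borel_measurable borel" by measurable
    moreover have "enn2real (ennreal (Y (s, \<omega>)) * indicator {0..} s) = Y (s, \<omega>) * indicator {0..} s" for s
      using Y0 by (simp add: indicator_def)
    ultimately have y: "(\<lambda>s. Y (s, \<omega>) * indicator {0..} s) \<in> borel_measurable borel" by simp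
    define y where "y s = Y (s, \<omega>) * indicator {0..} s" for s
    have [measurable]: "y \<in> borel_measurable borel" using y by (simp add: y_def[abs_def])
    let ?R = "\<lambda>s. indicator {0..t} s * (Y (s, \<omega>) * (2 * \<alpha> * (lam0 * lam (max 0 s) \<omega> - (lam (max 0 s) \<omega>)\<^sup>2)))"
    have R_eq: "?R s = indicator {0..t} s * (y s * (2 * \<alpha> * (lam0 * lam (max 0 s) \<omega> - (lam (max 0 s) \<omega>)\<^sup>2)))" for s
      by (simp add: y_def indicator_def)
    have R: "?R \<in> borel_measurable lborel"
      unfolding R_eq measurable_lborel1 by measurable
    have Dm: "(\<lambda>s. D (s, \<omega>)) \<in> borel_measurable lborel"
      by (rule measurable_compose[OF _ borel_measurable_integrable[OF D]]) (use \<omega> in measurable)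
    show ?case
    proof (rule integral_cong_AE[OF Dm R])
      show "AE s in lborel. D (s, \<omega>) = ?R s"
        using elim(1,2) by eventually_elim (simp add: D_def algebra_simps)
    qed
  qed
  show ?thesis
  proof
    let ?Z = "\<lambda>\<omega>. l\<^sup>2 + (LBINT s. D (s, \<omega>)) + (2 * \<beta> * S1 \<omega> + \<beta>\<^sup>2 * S2 \<omega>)"
    show "integrable M ?Z" using D_int S1 S2 by simp
    show "expectation ?Z = l\<^sup>2 + (2 * \<alpha> * lam0 + \<beta>\<^sup>2 * expectation (\<lambda>\<omega>. (X \<omega>)\<^sup>2)) * integral\<^sup>L (lborel \<Otimes>\<^sub>M M) H1
       + 2 * (\<beta> * expectation X - \<alpha>) * integral\<^sup>L (lborel \<Otimes>\<^sub>M M) H2"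
      using D_int S1 S2 by (simp add: D_val prob_space algebra_simps)
    show "AE \<omega> in M. ?Z \<omega> = stopped_square Y t \<omega>"
      using D_eq S1(3) S2(3)
    proof eventually_elim
      case (elim \<omega>)
      show ?case
        unfolding stopped_square_def elim sum_distrib_left sum.distrib[symmetric]
        by (intro arg_cong2[where f = "(+)"] sum.cong refl) (simp add: algebra_simps)
    qed
  qed
qed

subsection \<open>A priori bound of the second moment\<close>

lemma product_integral_up_to:
  fixes h :: "real \<times> 'a \<Rightarrow> real"
  assumes h [measurable]: "h \<in> borel_measurable (lborel \<Otimes>\<^sub>M M)" and "0 \<le> t"
    and bound: "\<And>s. 0 \<le> s \<Longrightarrow> s \<le> t \<Longrightarrow> (\<integral>\<^sup>+\<omega>. ennreal \<bar>h (s, \<omega>)\<bar> \<partial>M) \<le> ennreal K"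
  shows "integrable (lborel \<Otimes>\<^sub>M M) (\<lambda>w. indicator {0..t} (fst w) * h w)"
    and "integral\<^sup>L (lborel \<Otimes>\<^sub>M M) (\<lambda>w. indicator {0..t} (fst w) * h w) =
      (LINT s:{0..t}|lborel. expectation (\<lambda>\<omega>. h (s, \<omega>)))"
    and "set_integrable lborel {0..t} (\<lambda>s. expectation (\<lambda>\<omega>. h (s, \<omega>)))"
proof -
  let ?f = "\<lambda>w. indicator {0..t} (fst w) * h w"
  show int: "integrable (lborel \<Otimes>\<^sub>M M) ?f"
  proof (rule integrableI_bounded)
    have "(\<integral>\<^sup>+w. ennreal (norm (?f w)) \<partial>(lborel \<Otimes>\<^sub>M M)) = (\<integral>\<^sup>+s. (\<integral>\<^sup>+\<omega>. ennreal (norm (?f (s, \<omega>))) \<partial>M) \<partial>lborel)"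
      by (rule nn_integral_fst[symmetric]) measurable
    also have "\<dots> \<le> (\<integral>\<^sup>+s. ennreal K * indicator {0..t} s \<partial>lborel)"
    proof (rule nn_integral_mono)
      fix s :: real
      show "(\<integral>\<^sup>+\<omega>. ennreal (norm (?f (s, \<omega>))) \<partial>M) \<le> ennreal K * indicator {0..t} s"
        using bound[of s] by (auto simp: indicator_def)
    qed
    also have "\<dots> = ennreal K * ennreal t"
      using \<open>0 \<le> t\<close> by (simp add: nn_integral_cmult)
    also have "\<dots> < \<infinity>" by (simp add: ennreal_mult_less_top)
    finally show "(\<integral>\<^sup>+w. ennreal (norm (?f w)) \<partial>(lborel \<Otimes>\<^sub>M M)) < \<infinity>" .
  qed measurable
  show "integral\<^sup>L (lborel \<Otimes>\<^sub>M M) ?f = (LINT s:{0..t}|lborel. expectation (\<lambda>\<omega>. h (s, \<omega>)))"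
    using time.integral_fst'[OF int] by (simp add: set_lebesgue_integral_def)
  show "set_integrable lborel {0..t} (\<lambda>s. expectation (\<lambda>\<omega>. h (s, \<omega>)))"
    using time.integrable_fst'[OF int] by (simp add: set_integrable_def)
qed

lemma expectation_section_measurable:
  fixes h :: "real \<times> 'a \<Rightarrow> real"
  assumes h: "h \<in> borel_measurable (lborel \<Otimes>\<^sub>M M)"
  shows "(\<lambda>s. expectation (\<lambda>\<omega>. h (s, \<omega>))) \<in> borel_measurable borel"
  using borel_measurable_lebesgue_integral[of "\<lambda>s \<omega>. h (s, \<omega>)" lborel] h by simp

text \<open>On \<open>below k\<close> the truncation by \<open>k\<close> matters at most at the time of first passage, a null set;
  it makes the integrands bounded everywhere.\<close>

lemma truncated_second_moment_bound:
  fixes k :: nat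
  defines "\<rho> \<equiv> \<beta> * expectation X - \<alpha>"
  defines "A \<equiv> 2 * \<alpha> * lam0 + \<beta>\<^sup>2 * expectation (\<lambda>\<omega>. (X \<omega>)\<^sup>2)"
  defines "C \<equiv> \<bar>A\<bar> + 2 * \<bar>\<rho>\<bar> + 1"
  assumes t: "0 \<le> t"
  shows "expectation (\<lambda>\<omega>. indicator (below k) (t, \<omega>) * (min (real k) (lam t \<omega>))\<^sup>2) \<le>
    2 * (l\<^sup>2 + \<bar>A\<bar> * t) * exp (2 * C * t)"
proof -
  define Y :: "real \<times> 'a \<Rightarrow> real" where "Y = indicator (below k)"
  have Y_Pred: "Y \<in> borel_measurable Pred" unfolding Y_def using below_Pred by simp
  have "below k \<in> sets (lborel \<Otimes>\<^sub>M M)"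
    using below_Pred[of k] Pred_subset_product by (auto cong: sets_pair_measure_cong)
  then have [measurable]: "Y \<in> borel_measurable (lborel \<Otimes>\<^sub>M M)" unfolding Y_def by simp
  define h where "h p w = Y w * (min (real k) (lamR w)) ^ p" for p :: nat and w
  have [measurable]: "h p \<in> borel_measurable (lborel \<Otimes>\<^sub>M M)" for p
    unfolding h_def by measurable
  have h: "0 \<le> h p w" "h p w \<le> (real k) ^ p" for p w
    using lam_nonneg[of "snd w" "max 0 (fst w)"]
    by (auto simp: h_def Y_def indicator_def below_def split: prod.splits intro!: power_mono)
  have hb: "(\<integral>\<^sup>+\<omega>. ennreal \<bar>h p (s, \<omega>)\<bar> \<partial>M) \<le> ennreal ((real k) ^ p)" for p s
  proof -
    have "(\<integral>\<^sup>+\<omega>. ennreal \<bar>h p (s, \<omega>)\<bar> \<partial>M) \<le> (\<integral>\<^sup>+\<omega>. ennreal ((real k) ^ p) \<partial>M)"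
      using h by (intro nn_integral_mono ennreal_leI) simp
    then show ?thesis by (simp add: emeasure_space_1)
  qed
  define w where "w s = expectation (\<lambda>\<omega>. h 2 (s, \<omega>))" for s
  \<comment> \<open>The bound \<open>(real k)\<^sup>2\<close> on \<open>w\<close> only keeps the
    supremum in Gronwall's argument finite. It does not enter the conclusion, which is therefore
    uniform in \<open>k\<close>.\<close>
  have "w t \<le> 2 * (l\<^sup>2 + \<bar>A\<bar> * t) * exp (2 * C * t)"
  proof (rule gronwall_bounded[where K = "(real k)\<^sup>2"])
    show "w \<in> borel_measurable borel"
      unfolding w_def by (rule expectation_section_measurable) measurable
    show "0 \<le> l\<^sup>2 + \<bar>A\<bar> * t" "0 < C" "0 \<le> t" using t by (auto simp: C_def)
  next
    fix s assume s: "s \<in> {0..t}"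
    then have s0: "0 \<le> s" by simp
    have sec: "(\<lambda>\<omega>. h p (s, \<omega>)) \<in> borel_measurable M" for p by measurable
    have sec_int: "integrable M (\<lambda>\<omega>. h p (s, \<omega>))" for p
      using h by (intro integrable_const_bound[of _ "(real k) ^ p"] sec) auto
    have "w s \<le> (\<integral>\<omega>. (real k)\<^sup>2 \<partial>M)"
      unfolding w_def using h sec_int by (intro integral_mono) auto
    then show "0 \<le> w s \<and> w s \<le> (real k)\<^sup>2"
      using h by (auto simp: w_def prob_space)
    note H = product_integral_up_to[OF _ s0 hb]
    let ?H = "\<lambda>p w. indicator {0..s} (fst w) * h p w"
    have H_eq: "AE \<omega> in M. AE u in lborel. ?H p (u, \<omega>) = indicator {0..s} u * (Y (u, \<omega>) * (lam (max 0 u) \<omega>) ^ p)" for p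
      using AE_space
    proof eventually_elim
      case (elim \<omega>)
      from AE_below[OF this, of k] show ?case
        by eventually_elim (auto simp: h_def Y_def indicator_def)
    qed
    obtain Z where Z: "integrable M Z"
      "expectation Z = l\<^sup>2 + A * integral\<^sup>L (lborel \<Otimes>\<^sub>M M) (?H 1) + 2 * \<rho> * integral\<^sup>L (lborel \<Otimes>\<^sub>M M) (?H 2)"
      "AE \<omega> in M. Z \<omega> = stopped_square Y s \<omega>"
      unfolding A_def \<rho>_def
    proof (rule expectation_stopped_square[OF s0 Y_Pred, of "?H 1" "?H 2"])
      show "0 \<le> Y w" for w by (simp add: Y_def)
      show "integrable (lborel \<Otimes>\<^sub>M M) (?H 1)" "integrable (lborel \<Otimes>\<^sub>M M) (?H 2)"
        by (rule H(1), measurable)+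
      show "0 \<le> ?H 1 w" "0 \<le> ?H 2 w" for w using h by simp_all
      show "AE \<omega> in M. AE u in lborel. ?H 1 (u, \<omega>) = indicator {0..s} u * (Y (u, \<omega>) * lam (max 0 u) \<omega>)"
        using H_eq[of 1] by simp
      show "AE \<omega> in M. AE u in lborel. ?H 2 (u, \<omega>) = indicator {0..s} u * (Y (u, \<omega>) * (lam (max 0 u) \<omega>)\<^sup>2)"
        by (rule H_eq)
    qed
    \<comment> \<open>On \<open>below k\<close> the stopped square is the true square and dominates
      the truncated one. Off \<open>below k\<close> the left side is 0, while the stopped square is
      still the square of some value of the path.\<close>
    have "w s \<le> expectation Z"
      unfolding w_def
    proof (rule integral_mono_AE[OF sec_int Z(1)])
      show "AE \<omega> in M. h 2 (s, \<omega>) \<le> Z \<omega>"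
        using Z(3) AE_good
      proof eventually_elim
        case (elim \<omega>)
        obtain \<sigma> where \<sigma>: "0 \<le> \<sigma>" "stopped_square Y s \<omega> = (lam \<sigma> \<omega>)\<^sup>2" "(s, \<omega>) \<in> below k \<longrightarrow> \<sigma> = s"
          using stopped_square_below[OF elim(2) s0, of k] by (auto simp: Y_def)
        have "(min (real k) (lam s \<omega>))\<^sup>2 \<le> (lam s \<omega>)\<^sup>2"
          using lam_nonneg[OF good_space[OF elim(2)] s0] by (intro power_mono) auto
        then show ?case
          using \<sigma> s0 by (auto simp: elim(1) h_def Y_def indicator_def)
      qed
    qed
    \<comment> \<open>The first moment is absorbed by \<open>x \<le> 1 + x\<^sup>2\<close>: this
      produces \<open>\<bar>A\<bar> * t\<close> and the share \<open>\<bar>A\<bar>\<close> of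
      \<open>C\<close>. The summand 1 in \<open>C\<close> keeps it positive, as
      \<open>gronwall_bounded\<close> demands.\<close>
    also have "\<dots> \<le> l\<^sup>2 + \<bar>A\<bar> * t + C * integral\<^sup>L (lborel \<Otimes>\<^sub>M M) (?H 2)"
    proof -
      let ?I = "\<lambda>p. integral\<^sup>L (lborel \<Otimes>\<^sub>M M) (?H p)"
      have one: "integrable (lborel \<Otimes>\<^sub>M M) (\<lambda>w. indicator {0..s} (fst w) * (1::real))"
        "integral\<^sup>L (lborel \<Otimes>\<^sub>M M) (\<lambda>w. indicator {0..s} (fst w) * (1::real)) = s"
        using product_integral_up_to[of "\<lambda>_. 1" s 1] s0 by (simp_all add: emeasure_space_1 prob_space set_lebesgue_integral_def)
      have i: "integrable (lborel \<Otimes>\<^sub>M M) (?H p)" for p by (rule H(1)) measurable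
      have "?I 1 \<le> (\<integral>w. indicator {0..s} (fst w) * 1 + ?H 2 w \<partial>(lborel \<Otimes>\<^sub>M M))"
      proof (intro integral_mono i Bochner_Integration.integrable_add one)
        fix w :: "real \<times> 'a"
        show "?H 1 w \<le> indicator {0..s} (fst w) * 1 + ?H 2 w"
          by (simp add: h_def Y_def indicator_def le_one_plus_square)
      qed
      also have "\<dots> = s + ?I 2" using one i by simp
      finally have I1: "?I 1 \<le> s + ?I 2" .
      have I0: "0 \<le> ?I 1" "0 \<le> ?I 2" using h by (auto intro!: integral_nonneg_AE)
      have "A * ?I 1 \<le> \<bar>A\<bar> * ?I 1" using I0 by (intro mult_right_mono) auto
      also have "\<dots> \<le> \<bar>A\<bar> * (t + ?I 2)" using I1 s by (intro mult_left_mono) auto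
      finally have a: "A * ?I 1 \<le> \<bar>A\<bar> * t + \<bar>A\<bar> * ?I 2" by (simp add: distrib_left)
      have "2 * \<rho> * ?I 2 \<le> (2 * \<bar>\<rho>\<bar> + 1) * ?I 2" using I0 by (intro mult_right_mono) auto
      with a show ?thesis unfolding Z(2) C_def by (simp add: distrib_right)
    qed
    also have "integral\<^sup>L (lborel \<Otimes>\<^sub>M M) (?H 2) = (LINT u:{0..s}|lborel. w u)"
      unfolding w_def by (rule H(2)) measurable
    finally show "w s \<le> l\<^sup>2 + \<bar>A\<bar> * t + C * (LINT u:{0..s}|lborel. w u)" .
  qed
  then show ?thesis using t by (simp add: w_def h_def Y_def)
qed

text \<open>Uniformity over \<open>{0..t}\<close>, and not mere finiteness at each time, is what the
  Fubini arguments on \<open>{0..t} \<times> space M\<close> use later.\<close>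

lemma second_moment_bound:
  assumes "0 \<le> t"
  shows "\<exists>K. \<forall>s. 0 \<le> s \<longrightarrow> s \<le> t \<longrightarrow> (\<integral>\<^sup>+\<omega>. ennreal ((lam s \<omega>)\<^sup>2) \<partial>M) \<le> ennreal K"
proof -
  define \<rho> where "\<rho> = \<beta> * expectation X - \<alpha>"
  define A where "A = 2 * \<alpha> * lam0 + \<beta>\<^sup>2 * expectation (\<lambda>\<omega>. (X \<omega>)\<^sup>2)"
  define C where "C = \<bar>A\<bar> + 2 * \<bar>\<rho>\<bar> + 1"
  have "(\<integral>\<^sup>+\<omega>. ennreal ((lam s \<omega>)\<^sup>2) \<partial>M) \<le> ennreal (2 * (l\<^sup>2 + \<bar>A\<bar> * t) * exp (2 * C * t))"
    if s: "0 \<le> s" "s \<le> t" for s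
  proof -
    note [measurable] = lam_measurable[OF s(1)]
    define g where "g k \<omega> = indicator (below (real k)) (s, \<omega>) * (min (real k) (lam s \<omega>))\<^sup>2" for k :: nat and \<omega>
    have [measurable]: "g k \<in> borel_measurable M" for k
    proof -
      have [measurable]: "below k \<in> sets (lborel \<Otimes>\<^sub>M M)"
        using below_Pred[of k] Pred_subset_product by (auto cong: sets_pair_measure_cong)
      show ?thesis unfolding g_def by measurable
    qed
    have g: "0 \<le> g k \<omega>" "g k \<omega> \<le> (real k)\<^sup>2" for k \<omega>
      using lam_nonneg[OF _ s(1), of \<omega>] by (auto simp: g_def indicator_def below_def intro!: power_mono)
    have "(\<integral>\<^sup>+\<omega>. ennreal ((lam s \<omega>)\<^sup>2) \<partial>M) = (\<integral>\<^sup>+\<omega>. liminf (\<lambda>k. ennreal (g k \<omega>)) \<partial>M)"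
    proof (rule nn_integral_cong)
      fix \<omega> assume \<omega>: "\<omega> \<in> space M"
      have "eventually (\<lambda>k. ennreal ((lam s \<omega>)\<^sup>2) = ennreal (g k \<omega>)) sequentially"
        using eventually_below[OF \<omega> s(1)] eventually_ge_at_top[of "nat \<lceil>lam s \<omega>\<rceil>"]
      proof eventually_elim
        case (elim k)
        then have "lam s \<omega> \<le> real k" by linarith
        then show ?case using elim by (simp add: g_def)
      qed
      then have "(\<lambda>k. ennreal (g k \<omega>)) \<longlonglongrightarrow> ennreal ((lam s \<omega>)\<^sup>2)"
        by (rule Lim_transform_eventually[OF tendsto_const])
      then show "ennreal ((lam s \<omega>)\<^sup>2) = liminf (\<lambda>k. ennreal (g k \<omega>))"
        by (simp add: lim_imp_Liminf)
    qed
    also have "\<dots> \<le> liminf (\<lambda>k. \<integral>\<^sup>+\<omega>. ennreal (g k \<omega>) \<partial>M)"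
      by (rule nn_integral_liminf) measurable
    also have "\<dots> \<le> liminf (\<lambda>k::nat. ennreal (2 * (l\<^sup>2 + \<bar>A\<bar> * t) * exp (2 * C * t)))"
    proof (intro Liminf_mono always_eventually allI)
      fix k
      have "integrable M (g k)"
        using g by (intro integrable_const_bound[of _ "(real k)\<^sup>2"]) auto
      then have "(\<integral>\<^sup>+\<omega>. ennreal (g k \<omega>) \<partial>M) = ennreal (expectation (g k))"
        using g by (intro nn_integral_eq_integral) auto
      also have "\<dots> \<le> ennreal (2 * (l\<^sup>2 + \<bar>A\<bar> * s) * exp (2 * C * s))"
        unfolding A_def C_def \<rho>_def g_def by (intro ennreal_leI truncated_second_moment_bound s)
      also have "\<dots> \<le> ennreal (2 * (l\<^sup>2 + \<bar>A\<bar> * t) * exp (2 * C * t))"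
        using s by (intro ennreal_leI mult_mono add_mono mult_left_mono) (auto simp: C_def intro!: mult_left_mono)
      finally show "(\<integral>\<^sup>+\<omega>. ennreal (g k \<omega>) \<partial>M) \<le> ennreal (2 * (l\<^sup>2 + \<bar>A\<bar> * t) * exp (2 * C * t))" .
    qed
    also have "\<dots> = ennreal (2 * (l\<^sup>2 + \<bar>A\<bar> * t) * exp (2 * C * t))"
      by (rule Liminf_const) simp
    finally show ?thesis .
  qed
  then show ?thesis by blast
qed

lemma lam_square_integrable:
  assumes "0 \<le> t"
  shows "integrable M (\<lambda>\<omega>. (lam t \<omega>)\<^sup>2)"
proof -
  note [measurable] = lam_measurable[OF assms]
  obtain K where "(\<integral>\<^sup>+\<omega>. ennreal ((lam t \<omega>)\<^sup>2) \<partial>M) \<le> ennreal K"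
    using second_moment_bound[OF assms] assms by blast
  also have "\<dots> < \<infinity>" by simp
  finally show ?thesis by (intro integrableI_bounded) auto
qed

lemma lam_integrable:
  assumes "0 \<le> t"
  shows "integrable M (lam t)"
  using square_integrable_imp_integrable[OF lam_measurable lam_square_integrable] assms by simp

lemma first_moment_bound:
  assumes "0 \<le> t"
  shows "\<exists>K. \<forall>s. 0 \<le> s \<longrightarrow> s \<le> t \<longrightarrow> (\<integral>\<^sup>+\<omega>. ennreal (lam s \<omega>) \<partial>M) \<le> ennreal K"
proof -
  obtain K where K: "\<And>s. 0 \<le> s \<Longrightarrow> s \<le> t \<Longrightarrow> (\<integral>\<^sup>+\<omega>. ennreal ((lam s \<omega>)\<^sup>2) \<partial>M) \<le> ennreal K"
    using second_moment_bound[OF assms] by blast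
  have "(\<integral>\<^sup>+\<omega>. ennreal (lam s \<omega>) \<partial>M) \<le> ennreal (1 + max 0 K)" if s: "0 \<le> s" "s \<le> t" for s
  proof -
    note [measurable] = lam_measurable[OF s(1)]
    have "(\<integral>\<^sup>+\<omega>. ennreal (lam s \<omega>) \<partial>M) \<le> (\<integral>\<^sup>+\<omega>. ennreal (1 + (lam s \<omega>)\<^sup>2) \<partial>M)"
      by (intro nn_integral_mono ennreal_leI le_one_plus_square)
    also have "\<dots> = (\<integral>\<^sup>+\<omega>. 1 + ennreal ((lam s \<omega>)\<^sup>2) \<partial>M)"
      by (intro nn_integral_cong) (simp add: ennreal_plus)
    also have "\<dots> = 1 + (\<integral>\<^sup>+\<omega>. ennreal ((lam s \<omega>)\<^sup>2) \<partial>M)"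
      by (subst nn_integral_add) (auto simp: emeasure_space_1)
    also have "\<dots> \<le> 1 + ennreal (max 0 K)"
      using K[OF s] by (intro add_left_mono) (auto elim: order_trans intro: ennreal_leI)
    also have "\<dots> = ennreal (1 + max 0 K)" by (simp add: ennreal_plus)
    finally show ?thesis .
  qed
  then show ?thesis by blast
qed

subsection \<open>Moment equations\<close>

lemma
  assumes t: "0 \<le> t"
  shows first_moment_set_integrable: "set_integrable lborel {0..t} (\<lambda>s. expectation (lam (max 0 s)))"
    and second_moment_set_integrable: "set_integrable lborel {0..t} (\<lambda>s. expectation (\<lambda>\<omega>. (lam (max 0 s) \<omega>)\<^sup>2))"
    and first_moment_equation: "expectation (lam t) = l +
      (LINT s:{0..t}|lborel. \<alpha> * lam0 + (\<beta> * expectation X - \<alpha>) * expectation (lam (max 0 s)))"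
    and second_moment_equation: "expectation (\<lambda>\<omega>. (lam t \<omega>)\<^sup>2) = l\<^sup>2 +
      (LINT s:{0..t}|lborel. (2 * \<alpha> * lam0 + \<beta>\<^sup>2 * expectation (\<lambda>\<omega>. (X \<omega>)\<^sup>2)) * expectation (lam (max 0 s))
        + 2 * (\<beta> * expectation X - \<alpha>) * expectation (\<lambda>\<omega>. (lam (max 0 s) \<omega>)\<^sup>2))"
proof -
  obtain K where K: "(\<integral>\<^sup>+\<omega>. ennreal (lam s \<omega>) \<partial>M) \<le> ennreal K" if "0 \<le> s" "s \<le> t" for s
    using first_moment_bound[OF t] by blast
  obtain L where L: "(\<integral>\<^sup>+\<omega>. ennreal ((lam s \<omega>)\<^sup>2) \<partial>M) \<le> ennreal L" if "0 \<le> s" "s \<le> t" for s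
    using second_moment_bound[OF t] by blast
  have K': "(\<integral>\<^sup>+\<omega>. ennreal \<bar>lamR (s, \<omega>)\<bar> \<partial>M) \<le> ennreal K" if "0 \<le> s" "s \<le> t" for s
  proof -
    have "(\<integral>\<^sup>+\<omega>. ennreal \<bar>lamR (s, \<omega>)\<bar> \<partial>M) = (\<integral>\<^sup>+\<omega>. ennreal (lam s \<omega>) \<partial>M)"
      using that lam_nonneg by (intro nn_integral_cong) simp
    then show ?thesis using K[OF that] by simp
  qed
  have L': "(\<integral>\<^sup>+\<omega>. ennreal \<bar>(lamR (s, \<omega>))\<^sup>2\<bar> \<partial>M) \<le> ennreal L" if "0 \<le> s" "s \<le> t" for s
    using L[OF that] that by simp
  note I1 = product_integral_up_to[OF lamR_measurable t K']
  have "(\<lambda>w. (lamR w)\<^sup>2) \<in> borel_measurable (lborel \<Otimes>\<^sub>M M)" by measurable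
  note I2 = product_integral_up_to[OF this t L']
  \<comment> \<open>Non-negativity is demanded at every pair, also where \<open>snd w\<close> lies
    outside \<open>space M\<close> and the sign of \<open>lam\<close> is unknown; hence the absolute
    value.\<close>
  let ?H1 = "\<lambda>w. indicator {0..t} (fst w) * \<bar>lamR w\<bar>"
  let ?H2 = "\<lambda>w. indicator {0..t} (fst w) * (lamR w)\<^sup>2"
  let ?m1 = "\<lambda>s. expectation (lam (max 0 s))"
  let ?m2 = "\<lambda>s. expectation (\<lambda>\<omega>. (lam (max 0 s) \<omega>)\<^sup>2)"
  show m1: "set_integrable lborel {0..t} ?m1" using I1(3) by simp
  show m2: "set_integrable lborel {0..t} ?m2" using I2(3) by simp
  have const: "set_integrable lborel {0..t} (\<lambda>_. c :: real)" for c
    by (intro borel_integrable_atLeastAtMost' continuous_intros)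
  have abs_eq: "integral\<^sup>L (lborel \<Otimes>\<^sub>M M) ?H1 = (LINT s:{0..t}|lborel. ?m1 s)"
  proof -
    have "integral\<^sup>L (lborel \<Otimes>\<^sub>M M) ?H1 = integral\<^sup>L (lborel \<Otimes>\<^sub>M M) (\<lambda>w. indicator {0..t} (fst w) * lamR w)"
      by (intro Bochner_Integration.integral_cong) (auto simp: space_pair_measure lam_nonneg)
    then show ?thesis using I1(2) by simp
  qed
  have H1: "integrable (lborel \<Otimes>\<^sub>M M) ?H1"
    using integrable_abs[OF I1(1)] by (simp add: abs_mult)
  have H1_eq: "AE \<omega> in M. AE s in lborel. ?H1 (s, \<omega>) = indicator {0..t} s * (1 * lam (max 0 s) \<omega>)"
    using lam_nonneg by (auto intro!: AE_I2)
  obtain Z where Z: "integrable M Z"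
    "expectation Z = l\<^sup>2 + (2 * \<alpha> * lam0 + \<beta>\<^sup>2 * expectation (\<lambda>\<omega>. (X \<omega>)\<^sup>2)) * integral\<^sup>L (lborel \<Otimes>\<^sub>M M) ?H1
       + 2 * (\<beta> * expectation X - \<alpha>) * integral\<^sup>L (lborel \<Otimes>\<^sub>M M) ?H2"
    "AE \<omega> in M. Z \<omega> = stopped_square (\<lambda>_. 1) t \<omega>"
    by (rule expectation_stopped_square[OF t, of "\<lambda>_. 1" ?H1 ?H2])
      (use H1 H1_eq I2(1) in auto)
  have "expectation (\<lambda>\<omega>. (lam t \<omega>)\<^sup>2) = expectation Z"
  proof (rule integral_cong_AE)
    show "AE \<omega> in M. (lam t \<omega>)\<^sup>2 = Z \<omega>"
      using Z(3) AE_good by eventually_elim (simp add: stopped_square_one t)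
  qed (use Z(1) lam_measurable[OF t] in auto)
  then show "expectation (\<lambda>\<omega>. (lam t \<omega>)\<^sup>2) = l\<^sup>2 +
      (LINT s:{0..t}|lborel. (2 * \<alpha> * lam0 + \<beta>\<^sup>2 * expectation (\<lambda>\<omega>. (X \<omega>)\<^sup>2)) * ?m1 s + 2 * (\<beta> * expectation X - \<alpha>) * ?m2 s)"
    unfolding Z(2) abs_eq using I2(2) m1 m2 by (subst set_integral_add) simp_all
  \<comment> \<open>The jump part of the linear path, with weight 1 and the identity as mark
    function. Its compensator is the same \<open>?H1\<close>, which closes the equation for the
    mean.\<close>
  obtain S where S: "integrable M S"
    "expectation S = expectation X * integral\<^sup>L (lborel \<Otimes>\<^sub>M M) ?H1"
    "AE \<omega> in M. S \<omega> = (\<Sum>n\<in>arrivals t \<omega>. 1 * Xs n \<omega>)"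
    by (rule campbell_integrable[OF t, of "\<lambda>_. 1" "\<lambda>x. x" ?H1]) (use H1 H1_eq X_integrable in auto)
  define D where "D w = indicator {0..t} (fst w) * (\<alpha> * (lam0 - lamR w))" for w
  have D_eq: "D w = \<alpha> * lam0 * (indicator {0..t} (fst w) * 1) - \<alpha> * (indicator {0..t} (fst w) * lamR w)" for w
    by (simp add: D_def algebra_simps)
  have i1: "integrable (lborel \<Otimes>\<^sub>M M) (\<lambda>w. indicator {0..t} (fst w) * (1::real))"
    "integral\<^sup>L (lborel \<Otimes>\<^sub>M M) (\<lambda>w. indicator {0..t} (fst w) * (1::real)) = t"
    using product_integral_up_to[of "\<lambda>_. 1" t 1] t by (simp_all add: emeasure_space_1 prob_space set_lebesgue_integral_def)
  have D: "integrable (lborel \<Otimes>\<^sub>M M) D"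
    unfolding D_eq using i1(1) I1(1) by (intro Bochner_Integration.integrable_diff integrable_mult_right)
  have D_val: "integral\<^sup>L (lborel \<Otimes>\<^sub>M M) D = \<alpha> * lam0 * t - \<alpha> * (LINT s:{0..t}|lborel. ?m1 s)"
  proof -
    have "integrable (lborel \<Otimes>\<^sub>M M) (\<lambda>w. indicator {0..t} (fst w) * lamR w)"
      "integral\<^sup>L (lborel \<Otimes>\<^sub>M M) (\<lambda>w. indicator {0..t} (fst w) * lamR w) = (LINT s:{0..t}|lborel. ?m1 s)"
      using I1(1,2) by simp_all
    then show ?thesis
      unfolding D_eq using i1 by simp
  qed
  have D_int: "integrable M (\<lambda>\<omega>. LBINT s. D (s, \<omega>))"
    "expectation (\<lambda>\<omega>. LBINT s. D (s, \<omega>)) = integral\<^sup>L (lborel \<Otimes>\<^sub>M M) D"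
    using time.integrable_snd[of "\<lambda>s \<omega>. D (s, \<omega>)"] time.integral_snd[of "\<lambda>s \<omega>. D (s, \<omega>)"] D by simp_all
  have "expectation (lam t) = expectation (\<lambda>\<omega>. l + (LBINT s. D (s, \<omega>)) + \<beta> * S \<omega>)"
  proof (rule integral_cong_AE)
    show "AE \<omega> in M. lam t \<omega> = l + (LBINT s. D (s, \<omega>)) + \<beta> * S \<omega>"
      using S(3) AE_good
    proof eventually_elim
      case (elim \<omega>)
      show ?case
        using linear_path[OF elim(2) t] elim(1) by (simp add: D_def sum_distrib_left)
    qed
  qed (use D_int(1) S(1) lam_measurable[OF t] in \<open>auto intro!: borel_measurable_add borel_measurable_times\<close>)
  also have "\<dots> = l + (\<alpha> * lam0 * t - \<alpha> * (LINT s:{0..t}|lborel. ?m1 s)) + \<beta> * (expectation X * (LINT s:{0..t}|lborel. ?m1 s))"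
    using D_int S by (simp add: prob_space D_val abs_eq)
  also have "\<dots> = l + (LINT s:{0..t}|lborel. \<alpha> * lam0 + (\<beta> * expectation X - \<alpha>) * ?m1 s)"
    using m1 const t by (subst set_integral_add) (simp_all add: set_integral_const algebra_simps)
  finally show "expectation (lam t) = l + (LINT s:{0..t}|lborel. \<alpha> * lam0 + (\<beta> * expectation X - \<alpha>) * ?m1 s)" .
qed

end

section \<open>Solution of the moment equations\<close>

theorem mainTheorem3:
  fixes M :: "'a measure" and F :: "ennreal \<Rightarrow> 'a measure"
    and T :: "nat \<Rightarrow> 'a \<Rightarrow> ennreal"
    and X :: "'a \<Rightarrow> real" and Xs :: "nat \<Rightarrow> 'a \<Rightarrow> real"
    and \<alpha> \<beta> lam0 l \<rho> A v0 v1 v2 :: real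
    and lam :: "real \<Rightarrow> 'a \<Rightarrow> real" and m v :: "real \<Rightarrow> real"
  assumes "linear_self_exciting M F T X Xs \<alpha> \<beta> lam0 l lam"
    and "0 < l"
    and "\<rho> = \<beta> * prob_space.expectation M X - \<alpha>"
    and "A = 2 * \<alpha> * lam0 + \<beta>\<^sup>2 * prob_space.expectation M (\<lambda>\<omega>. (X \<omega>)\<^sup>2)"
    and "\<And>t. m t = prob_space.expectation M (\<lambda>\<omega>. lam t \<omega>)"
    and "\<And>t. v t = prob_space.expectation M (\<lambda>\<omega>. (lam t \<omega>)\<^sup>2)"
    and "v0 = A * \<alpha> * lam0 / (2 * \<rho>\<^sup>2)"
    and "v1 = - (A / \<rho>) * (\<alpha> * lam0 / \<rho> + l)"
    and "v2 = A / (2 * \<rho>\<^sup>2) * (\<alpha> * lam0 + 2 * \<rho> * l) + l\<^sup>2"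
  shows "(\<forall>t\<ge>0. integrable M (\<lambda>\<omega>. lam t \<omega>) \<and> integrable M (\<lambda>\<omega>. (lam t \<omega>)\<^sup>2)) \<and>
         (\<forall>t\<ge>0. (v has_real_derivative A * m t + 2 * \<rho> * v t) (at t within {0..})) \<and>
         v 0 = l\<^sup>2 \<and>
         (\<rho> \<noteq> 0 \<longrightarrow> (\<forall>t\<ge>0. v t = v0 + v1 * exp (\<rho> * t) + v2 * exp (2 * \<rho> * t)))"
proof -
  interpret linear_self_exciting M F T X Xs \<alpha> \<beta> lam0 l lam by fact
  note \<rho> = assms(3) and A = assms(4) and m = assms(5) and v = assms(6)
  let ?m = "\<lambda>s. expectation (lam (max 0 s))" and ?v = "\<lambda>s. expectation (\<lambda>\<omega>. (lam (max 0 s) \<omega>)\<^sup>2)"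
  have m_eq: "?m t = l + (LINT s:{0..t}|lborel. \<alpha> * lam0 + \<rho> * ?m s)" if "0 \<le> t" for t
    using first_moment_equation[OF that] that by (simp add: \<rho>)
  have v_eq: "?v t = l\<^sup>2 + (LINT s:{0..t}|lborel. A * ?m s + 2 * \<rho> * ?v s)" if "0 \<le> t" for t
    using second_moment_equation[OF that] that by (simp add: \<rho> A)
  have const: "set_integrable lborel {0..t} (\<lambda>_. \<alpha> * lam0)" for t :: real
    by (intro borel_integrable_atLeastAtMost' continuous_intros)
  have m_cont: "continuous_on {0..} ?m"
    by (rule continuous_on_of_integral_equation[OF m_eq])
      (auto intro!: set_integral_add const set_integrable_mult_right first_moment_set_integrable)
  have v_cont: "continuous_on {0..} ?v"
    by (rule continuous_on_of_integral_equation[OF v_eq])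
      (auto intro!: set_integral_add set_integrable_mult_right first_moment_set_integrable second_moment_set_integrable)
  have m_deriv: "(?m has_real_derivative \<alpha> * lam0 + \<rho> * ?m t) (at t within {0..})" if "0 \<le> t" for t
    by (rule has_derivative_of_integral_equation[OF m_eq _ that]) (assumption, intro continuous_intros m_cont)
  have v_deriv: "(?v has_real_derivative A * ?m t + 2 * \<rho> * ?v t) (at t within {0..})" if "0 \<le> t" for t
    by (rule has_derivative_of_integral_equation[OF v_eq _ that]) (assumption, intro continuous_intros m_cont v_cont)
  have m_0: "expectation (lam 0) = l"
    using initial by (simp add: prob_space cong: Bochner_Integration.integral_cong)
  have v_0: "expectation (\<lambda>\<omega>. (lam 0 \<omega>)\<^sup>2) = l\<^sup>2"
    using initial by (simp add: prob_space cong: Bochner_Integration.integral_cong)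
  have m': "m t = ?m t" and v': "v t = ?v t" if "0 \<le> t" for t
    using that by (simp_all add: m v)
  have "(v has_real_derivative A * m t + 2 * \<rho> * v t) (at t within {0..})" if "0 \<le> t" for t
    using has_field_derivative_transform_within[OF v_deriv[OF that], of 1 v] that m' v' by auto
  moreover have "v t = v0 + v1 * exp (\<rho> * t) + v2 * exp (2 * \<rho> * t)" if nz: "\<rho> \<noteq> 0" and t: "0 \<le> t" for t
  proof -
    \<comment> \<open>The mean solves \<open>m' = \<alpha> * lam0 + \<rho> * m\<close> with
      \<open>m 0 = l\<close>: the stationary value is \<open>- \<alpha> * lam0 / \<rho>\<close>, and
      the initial deviation from it grows like \<open>exp (\<rho> * s)\<close>.\<close>
    define q where "q s = (l + \<alpha> * lam0 / \<rho>) * exp (\<rho> * s) - \<alpha> * lam0 / \<rho>" for s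
    have m_q: "?m s = q s" if "0 \<le> s" for s
    proof (rule linear_ode_unique[OF m_deriv _ _ that])
      fix t
      show "(q has_real_derivative \<alpha> * lam0 + \<rho> * q t) (at t within {0..})"
        unfolding q_def using nz by (auto intro!: derivative_eq_intros simp: field_simps)
    qed (simp_all add: m_0 q_def)
    have "?v t = v0 + v1 * exp (\<rho> * t) + v2 * exp (2 * \<rho> * t)"
    proof (rule linear_ode_unique[OF v_deriv _ _ t])
      fix s :: real assume "0 \<le> s"
      \<comment> \<open>Comparison of coefficients in \<open>v' = A * q + 2 * \<rho> * v\<close>:
        the constant term determines \<open>v0\<close> and the term in
        \<open>exp (\<rho> * s)\<close> determines \<open>v1\<close>. The term in
        \<open>exp (2 * \<rho> * s)\<close> solves the homogeneous equation, so \<open>v2\<close> is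
        left to the initial value.\<close>
      have c: "2 * \<rho> * v0 = A * (\<alpha> * lam0 / \<rho>)" "\<rho> * v1 = - A * (l + \<alpha> * lam0 / \<rho>)"
        using nz by (simp_all add: assms(7,8) power2_eq_square field_simps)
      have "((\<lambda>t. v0 + v1 * exp (\<rho> * t) + v2 * exp (2 * \<rho> * t)) has_real_derivative
          \<rho> * v1 * exp (\<rho> * s) + 2 * \<rho> * v2 * exp (2 * \<rho> * s)) (at s within {0..})"
        by (auto intro!: derivative_eq_intros)
      moreover have "\<rho> * v1 * exp (\<rho> * s) + 2 * \<rho> * v2 * exp (2 * \<rho> * s) =
          A * q s + 2 * \<rho> * (v0 + v1 * exp (\<rho> * s) + v2 * exp (2 * \<rho> * s))"
      proof -
        have "A * q s + 2 * \<rho> * v0 = - (\<rho> * v1) * exp (\<rho> * s)"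
          unfolding c q_def by (simp add: algebra_simps)
        then show ?thesis by (simp add: algebra_simps)
      qed
      ultimately show "((\<lambda>t. v0 + v1 * exp (\<rho> * t) + v2 * exp (2 * \<rho> * t)) has_real_derivative
          A * ?m s + 2 * \<rho> * (v0 + v1 * exp (\<rho> * s) + v2 * exp (2 * \<rho> * s))) (at s within {0..})"
        by (simp add: m_q[OF \<open>0 \<le> s\<close>])
    next
      show "?v 0 = v0 + v1 * exp (\<rho> * 0) + v2 * exp (2 * \<rho> * 0)"
      proof -
        have "v0 + v1 + v2 = l\<^sup>2"
          using nz by (simp add: assms(7-9) power2_eq_square field_simps)
        then show ?thesis by (simp add: v_0)
      qed
    qed
    then show ?thesis by (simp add: v' t)
  qed
  ultimately show ?thesis
    using lam_integrable lam_square_integrable v'[of 0] v_0 by auto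
qed

end
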